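(* Let $K$ be a field, and for $n\ge 1$ let $N_n$ be the polylinear (multilinear) part of the free Novikov algebra over $K$ on $n$ generators $x_1,\dots,x_n$. Then: (1) for every $n\ge 1$, $$\dim_K N_n=\binom{2n-2}{n-1};$$ (2) the codimension exponent of the variety of Novikov algebras, $Exp(Nov)=\lim_{n\to\infty}(\dim_K N_n)^{1/n}$, exists, and $Exp(Nov)=4$; (3) the generating function of the codimensions sequence is $$\sum_{n\ge 1}(\dim_K N_n)\,x^n = x(1-4x)^{-1/2}$$ (as an identity of formal power series).
   Context: An algebra over a field $K$ is a $K$-vector space $A$ with a bilinear multiplication $\circ$, not assumed associative or unital. Its associator is $(a,b,c)=a\circ(b\circ c)-(a\circ b)\circ c$. The algebra $(A,\circ)$ is called Novikov if for all $a,b,c\in A$ $$(a,b,c)=(a,c,b)\quad\text{and}\quad a\circ(b\circ c)=b\circ(a\circ c).$$ Let $Nov$ denote the variety of Novikov algebras. The free Novikov algebra on $x_1,\dots,x_n$ is the quotient of the free nonassociative non-unital $K$-algebra on $x_1,\dots,x_n$ by the ideal generated by all values of the two identities above, that is, by all elements $(a,b,c)-(a,c,b)$ and $a\circ(b\circ c)-b\circ(a\circ c)$ with $a,b,c$ in the free nonassociative algebra. Its polylinear part $N_n$ is the subspace spanned by the (images of) nonassociative monomials in which each generator $x_1,\dots,x_n$ occurs exactly once. The number $\dim_K N_n$ is called the $n$-th codimension of the variety $Nov$, and the codimension exponent is $Exp(Nov)=\lim_{n\to\infty}(\dim_K N_n)^{1/n}$. *)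

theory Defs
  imports
    "Jordan_Normal_Form.VS_Connect"
    "HOL-Algebra.QuotRing"
    "HOL-Library.Poly_Mapping"
    "HOL-Computational_Algebra.Formal_Power_Series"
    Complex_Main
begin

hide_const (open) Multiset.mult Polynomial.smult Modules.module

section \<open>Nonassociative algebras\<close>

text \<open>
  An algebra over \<open>K\<close> is a \<^typ>\<open>('k, 'a) module\<close> record whose field \<^const>\<open>mult\<close> is the (not
  necessarily associative) multiplication. The field \<^const>\<open>one\<close> of the record is never used: the
  algebras here have no unit.
\<close>

locale nonassoc_algebra = vectorspace K A for K and A :: "('k, 'a) module" (structure) +
  assumes mult_closed: "\<lbrakk>x \<in> carrier A; y \<in> carrier A\<rbrakk> \<Longrightarrow> x \<otimes> y \<in> carrier A"
    and mult_add_left: "\<lbrakk>x \<in> carrier A; y \<in> carrier A; z \<in> carrier A\<rbrakk>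
      \<Longrightarrow> (x \<oplus> y) \<otimes> z = (x \<otimes> z) \<oplus> (y \<otimes> z)"
    and mult_add_right: "\<lbrakk>x \<in> carrier A; y \<in> carrier A; z \<in> carrier A\<rbrakk>
      \<Longrightarrow> z \<otimes> (x \<oplus> y) = (z \<otimes> x) \<oplus> (z \<otimes> y)"
    and mult_smult_left: "\<lbrakk>c \<in> carrier K; x \<in> carrier A; y \<in> carrier A\<rbrakk>
      \<Longrightarrow> (c \<odot> x) \<otimes> y = c \<odot> (x \<otimes> y)"
    and mult_smult_right: "\<lbrakk>c \<in> carrier K; x \<in> carrier A; y \<in> carrier A\<rbrakk>
      \<Longrightarrow> x \<otimes> (c \<odot> y) = c \<odot> (x \<otimes> y)"

definition associator :: "('k, 'a) module \<Rightarrow> 'a \<Rightarrow> 'a \<Rightarrow> 'a \<Rightarrow> 'a" where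
  "associator A a b c = (a \<otimes>\<^bsub>A\<^esub> (b \<otimes>\<^bsub>A\<^esub> c)) \<ominus>\<^bsub>A\<^esub> ((a \<otimes>\<^bsub>A\<^esub> b) \<otimes>\<^bsub>A\<^esub> c)"

locale novikov_algebra = nonassoc_algebra K A for K and A :: "('k, 'a) module" (structure) +
  assumes right_symmetric: "\<lbrakk>a \<in> carrier A; b \<in> carrier A; c \<in> carrier A\<rbrakk>
      \<Longrightarrow> associator A a b c = associator A a c b"
    and left_commutative: "\<lbrakk>a \<in> carrier A; b \<in> carrier A; c \<in> carrier A\<rbrakk>
      \<Longrightarrow> a \<otimes> (b \<otimes> c) = b \<otimes> (a \<otimes> c)"

definition novikov_values :: "('k, 'a) module \<Rightarrow> 'a set" where
  "novikov_values A =
     {associator A a b c \<ominus>\<^bsub>A\<^esub> associator A a c b | a b c.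
        a \<in> carrier A \<and> b \<in> carrier A \<and> c \<in> carrier A} \<union>
     {(a \<otimes>\<^bsub>A\<^esub> (b \<otimes>\<^bsub>A\<^esub> c)) \<ominus>\<^bsub>A\<^esub> (b \<otimes>\<^bsub>A\<^esub> (a \<otimes>\<^bsub>A\<^esub> c)) | a b c.
        a \<in> carrier A \<and> b \<in> carrier A \<and> c \<in> carrier A}"

text \<open>Two-sided ideals, without the ring axioms imposed by the library's \<^const>\<open>ideal\<close>.\<close>

definition alg_ideal :: "('k, 'c) ring_scheme \<Rightarrow> ('k, 'a) module \<Rightarrow> 'a set \<Rightarrow> bool" where
  "alg_ideal K A I \<longleftrightarrow> VectorSpace.subspace K I A \<and>
     (\<forall>i\<in>I. \<forall>a\<in>carrier A. a \<otimes>\<^bsub>A\<^esub> i \<in> I \<and> i \<otimes>\<^bsub>A\<^esub> a \<in> I)"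

definition gen_alg_ideal :: "('k, 'c) ring_scheme \<Rightarrow> ('k, 'a) module \<Rightarrow> 'a set \<Rightarrow> 'a set" where
  "gen_alg_ideal K A S = \<Inter>{I. alg_ideal K A I \<and> S \<subseteq> I}"

text \<open>
  Neither \<^const>\<open>FactRing\<close> nor its ingredients presuppose associativity or a unit; only the
  scalar multiplication has to be added.
\<close>

definition quot_alg :: "('k, 'a) module \<Rightarrow> 'a set \<Rightarrow> ('k, 'a set) module" where
  "quot_alg A I = ring.extend (A Quot I)
     (module.fields (\<lambda>c U. \<Union>u\<in>U. I +>\<^bsub>A\<^esub> (c \<odot>\<^bsub>A\<^esub> u)))"


section \<open>The free nonassociative algebra\<close>

datatype 'v nonassoc_monom = Gen 'v | Mul "'v nonassoc_monom" "'v nonassoc_monom"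

primrec gens :: "'v nonassoc_monom \<Rightarrow> 'v multiset" where
  "gens (Gen v) = {#v#}"
| "gens (Mul s t) = gens s + gens t"

definition nonassoc_mult ::
  "('v nonassoc_monom \<Rightarrow>\<^sub>0 'k::field) \<Rightarrow> ('v nonassoc_monom \<Rightarrow>\<^sub>0 'k) \<Rightarrow> ('v nonassoc_monom \<Rightarrow>\<^sub>0 'k)" where
  "nonassoc_mult f g = (\<Sum>s\<in>Poly_Mapping.keys f. \<Sum>t\<in>Poly_Mapping.keys g.
     Poly_Mapping.single (Mul s t) (Poly_Mapping.lookup f s * Poly_Mapping.lookup g t))"

definition free_nonassoc :: "'v set \<Rightarrow> ('k::field, 'v nonassoc_monom \<Rightarrow>\<^sub>0 'k) module" where
  "free_nonassoc X =
     \<lparr>carrier = {f. \<forall>t\<in>Poly_Mapping.keys f. set_mset (gens t) \<subseteq> X},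
      mult = nonassoc_mult, one = undefined, zero = 0, add = (+),
      smult = (\<lambda>c. Poly_Mapping.map ((*) c))\<rparr>"


section \<open>The free Novikov algebra and the codimensions of the Novikov variety\<close>

definition novikov_ideal :: "'v set \<Rightarrow> ('v nonassoc_monom \<Rightarrow>\<^sub>0 'k::field) set" where
  "novikov_ideal X = gen_alg_ideal class_ring (free_nonassoc X) (novikov_values (free_nonassoc X))"

definition free_novikov :: "'v set \<Rightarrow> ('k::field, ('v nonassoc_monom \<Rightarrow>\<^sub>0 'k) set) module" where
  "free_novikov X = quot_alg (free_nonassoc X) (novikov_ideal X)"

definition novikov_monom ::
  "'v set \<Rightarrow> 'v nonassoc_monom \<Rightarrow> ('v nonassoc_monom \<Rightarrow>\<^sub>0 'k::field) set" where
  "novikov_monom X t = novikov_ideal X +>\<^bsub>free_nonassoc X :: ('k, _) module\<^esub> Poly_Mapping.single t 1"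

definition multilinear_monoms :: "'v set \<Rightarrow> 'v nonassoc_monom set" where
  "multilinear_monoms X = {t. set_mset (gens t) \<subseteq> X \<and> (\<forall>x\<in>X. count (gens t) x = 1)}"

definition multilinear_novikov :: "'v set \<Rightarrow> ('v nonassoc_monom \<Rightarrow>\<^sub>0 'k::field) set set" where
  "multilinear_novikov X =
     LinearCombinations.module.span class_ring (free_novikov X) (novikov_monom X ` multilinear_monoms X)"

definition novikov_codim :: "'k::field itself \<Rightarrow> nat \<Rightarrow> nat" where
  "novikov_codim _ n = vectorspace.dim (class_ring :: 'k ring)
     ((free_novikov {1..n})\<lparr>carrier := multilinear_novikov {1..n}\<rparr>)"

text \<open>Meaningful only where the limit exists.\<close>

definition codim_exponent :: "(nat \<Rightarrow> nat) \<Rightarrow> real" where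
  "codim_exponent c = lim (\<lambda>n. root n (real (c n)))"


section \<open>Well-definedness\<close>

lemma lookup_smult [simp]:
  "Poly_Mapping.lookup (Poly_Mapping.map ((*) (c::'k::field)) f) t = c * Poly_Mapping.lookup f t"
  by (simp add: Poly_Mapping.map.rep_eq when_def)

lemma lookup_nonassoc_mult [simp]:
  "Poly_Mapping.lookup (nonassoc_mult f g) u =
     (case u of Gen v \<Rightarrow> 0 | Mul s t \<Rightarrow> Poly_Mapping.lookup f s * Poly_Mapping.lookup g t)"
proof (cases u)
  case (Gen v)
  then show ?thesis
    by (simp add: nonassoc_mult_def lookup_sum lookup_single when_def)
next
  case (Mul s t)
  have "Poly_Mapping.lookup (nonassoc_mult f g) u =
      (\<Sum>s'\<in>Poly_Mapping.keys f. if s' = s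
        then \<Sum>t'\<in>Poly_Mapping.keys g. if t' = t
          then Poly_Mapping.lookup f s' * Poly_Mapping.lookup g t' else 0
        else 0)"
    unfolding nonassoc_mult_def lookup_sum Mul lookup_single when_def
    by (intro sum.cong refl) (auto intro!: sum.neutral sum.cong)
  also have "\<dots> = Poly_Mapping.lookup f s * Poly_Mapping.lookup g t"
    by (simp add: sum.delta in_keys_iff)
  finally show ?thesis by (simp add: Mul)
qed

lemma free_nonassoc_simps [simp]:
  "f \<in> carrier (free_nonassoc X) \<longleftrightarrow>
     (\<forall>t. Poly_Mapping.lookup f t \<noteq> 0 \<longrightarrow> set_mset (gens t) \<subseteq> X)"
  "mult (free_nonassoc X) = nonassoc_mult"
  "zero (free_nonassoc X) = 0"
  "add (free_nonassoc X) = (+)"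
  "smult (free_nonassoc X) = (\<lambda>c. Poly_Mapping.map ((*) c))"
  by (auto simp: free_nonassoc_def in_keys_iff)

lemma vectorspace_free_nonassoc:
  "vectorspace (class_ring :: 'k::field ring) (free_nonassoc X :: ('k, 'v nonassoc_monom \<Rightarrow>\<^sub>0 'k) module)"
proof (rule vs_criteria, goal_cases)
  case 1
  show ?case by (rule class_field)
next
  case 3
  show ?case
    unfolding free_nonassoc_simps lookup_add
    by (metis add.right_neutral add_cancel_left_left)
next
  case 4
  show ?case
  proof
    fix v :: "'v nonassoc_monom \<Rightarrow>\<^sub>0 'k"
    assume "v \<in> carrier (free_nonassoc X)"
    then show "\<exists>w\<in>carrier (free_nonassoc X). v \<oplus>\<^bsub>free_nonassoc X\<^esub> w = \<zero>\<^bsub>free_nonassoc X\<^esub>"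
      by (intro bexI[of _ "- v"]) auto
  qed
qed (auto intro!: poly_mapping_eqI simp: lookup_add algebra_simps)

lemma nonassoc_algebra_free_nonassoc:
  "nonassoc_algebra (class_ring :: 'k::field ring) (free_nonassoc X :: ('k, _) module)"
proof -
  interpret vectorspace "class_ring :: 'k ring" "free_nonassoc X :: ('k, _) module"
    by (rule vectorspace_free_nonassoc)
  show ?thesis
  proof (unfold_locales, goal_cases)
    case (1 x y)
    then show ?case
      unfolding free_nonassoc_simps lookup_nonassoc_mult
      by (intro allI) (simp split: nonassoc_monom.split)
  qed (rule poly_mapping_eqI, simp add: lookup_add algebra_simps split: nonassoc_monom.split)+
qed

context nonassoc_algebra
begin

lemma alg_ideal_carrier: "alg_ideal K A (carrier A)"
  unfolding alg_ideal_def VectorSpace.subspace_def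
  using mult_closed vectorspace_axioms by (auto intro!: submodule.intro module_axioms)

lemma alg_ideal_gen_alg_ideal:
  assumes "S \<subseteq> carrier A"
  shows "alg_ideal K A (gen_alg_ideal K A S)"
proof -
  have "carrier A \<in> {I. alg_ideal K A I \<and> S \<subseteq> I}"
    using alg_ideal_carrier assms by simp
  then show ?thesis
    unfolding gen_alg_ideal_def alg_ideal_def VectorSpace.subspace_def
      LinearCombinations.submodule_def
    by auto
qed

lemma associator_closed:
  "\<lbrakk>a \<in> carrier A; b \<in> carrier A; c \<in> carrier A\<rbrakk> \<Longrightarrow> associator A a b c \<in> carrier A"
  by (simp add: associator_def mult_closed)

lemma novikov_values_closed: "novikov_values A \<subseteq> carrier A"
  by (auto simp: novikov_values_def associator_closed mult_closed)

context
  fixes I assumes I: "alg_ideal K A I"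
begin

lemma abelian_subgroup_alg_ideal: "abelian_subgroup I A"
proof -
  have "VectorSpace.subspace K I A" using I by (simp add: alg_ideal_def)
  then have sub: "LinearCombinations.submodule K I A" by (simp add: VectorSpace.subspace_def)
  show ?thesis
  proof (rule abelian_subgroupI3)
    show "additive_subgroup I A"
    proof (rule additive_subgroup.intro, rule group.subgroupI)
      show "group (add_monoid A)" using M.a_group .
      show "I \<subseteq> carrier (add_monoid A)" using sub by (simp add: LinearCombinations.submodule_def)
      show "I \<noteq> {}" using sub by (auto simp: LinearCombinations.submodule_def)
      fix a assume a: "a \<in> I"
      then have aA: "a \<in> carrier A" using sub by (auto simp: LinearCombinations.submodule_def)
      have "(\<ominus>\<^bsub>K\<^esub> \<one>\<^bsub>K\<^esub>) \<odot> a \<in> I"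
        using sub a by (simp add: LinearCombinations.submodule_def)
      moreover have "(\<ominus>\<^bsub>K\<^esub> \<one>\<^bsub>K\<^esub>) \<odot> a = \<ominus> a" using aA by (simp add: smult_l_minus)
      ultimately show "inv\<^bsub>add_monoid A\<^esub> a \<in> I" by (simp add: a_inv_def)
      fix b assume "b \<in> I"
      then show "a \<otimes>\<^bsub>add_monoid A\<^esub> b \<in> I"
        using sub a by (simp add: LinearCombinations.submodule_def)
    qed
    show "abelian_group A" ..
  qed
qed

interpretation I: abelian_subgroup I A by (rule abelian_subgroup_alg_ideal)

lemma alg_ideal_smult: "c \<in> carrier K \<Longrightarrow> i \<in> I \<Longrightarrow> c \<odot> i \<in> I"
  using I by (simp add: alg_ideal_def VectorSpace.subspace_def LinearCombinations.submodule_def)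

lemma coset_eqI:
  "\<lbrakk>i \<in> I; x \<in> carrier A\<rbrakk> \<Longrightarrow> I +> (i \<oplus> x) = I +> x"
  using I.a_rcos_sum[of i x] I.rcosets_add_eq[of "I +> x"] M.a_coset_join2[of i I]
    M.a_rcosetsI[of I x] I.a_subgroup I.a_subset
  by auto

lemma quot_carrier: "carrier (quot_alg A I) = {I +> x | x. x \<in> carrier A}"
  by (auto simp: quot_alg_def ring.defs module.defs FactRing_def A_RCOSETS_def' )

lemma quot_zero: "\<zero>\<^bsub>quot_alg A I\<^esub> = I +> \<zero>"
  using M.a_coset_join2[OF M.zero_closed I.a_subgroup I.zero_closed]
  by (simp add: quot_alg_def ring.defs module.defs FactRing_def)

lemma quot_add:
  "\<lbrakk>x \<in> carrier A; y \<in> carrier A\<rbrakk> \<Longrightarrow> (I +> x) \<oplus>\<^bsub>quot_alg A I\<^esub> (I +> y) = I +> (x \<oplus> y)"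
  by (simp add: quot_alg_def ring.defs module.defs FactRing_def I.a_rcos_sum)

lemma quot_smult:
  assumes "c \<in> carrier K" "x \<in> carrier A"
  shows "c \<odot>\<^bsub>quot_alg A I\<^esub> (I +> x) = I +> (c \<odot> x)"
proof -
  have eq: "I +> (c \<odot> u) = I +> (c \<odot> x)" if "u \<in> I +> x" for u
  proof -
    from that obtain i where i: "i \<in> I" "u = i \<oplus> x" by (auto simp: a_r_coset_def')
    then have "c \<odot> u = (c \<odot> i) \<oplus> (c \<odot> x)"
      using assms I.a_subset by (auto intro: smult_r_distr)
    then show ?thesis using i assms alg_ideal_smult by (simp add: coset_eqI)
  qed
  have "c \<odot>\<^bsub>quot_alg A I\<^esub> (I +> x) = (\<Union>u\<in>I +> x. I +> (c \<odot> u))"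
    by (simp add: quot_alg_def ring.defs module.defs)
  also have "\<dots> = I +> (c \<odot> x)" using eq I.a_rcos_self[OF assms(2)] by blast
  finally show ?thesis .
qed

lemma quot_mult:
  assumes "x \<in> carrier A" "y \<in> carrier A"
  shows "(I +> x) \<otimes>\<^bsub>quot_alg A I\<^esub> (I +> y) = I +> (x \<otimes> y)"
proof -
  have eq: "I +> (u \<otimes> v) = I +> (x \<otimes> y)" if "u \<in> I +> x" "v \<in> I +> y" for u v
  proof -
    from that obtain i j where i: "i \<in> I" "u = i \<oplus> x" and j: "j \<in> I" "v = j \<oplus> y"
      by (auto simp: a_r_coset_def')
    have c: "i \<in> carrier A" "j \<in> carrier A" using i j I.a_subset by auto
    have "v \<in> carrier A" using assms c j by simp
    then have "u \<otimes> v = (i \<otimes> v) \<oplus> (x \<otimes> v)"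
      using assms c i by (simp add: mult_add_left)
    also have "x \<otimes> v = (x \<otimes> j) \<oplus> (x \<otimes> y)"
      using assms c j by (simp add: mult_add_right)
    finally have "u \<otimes> v = (i \<otimes> v) \<oplus> ((x \<otimes> j) \<oplus> (x \<otimes> y))" .
    moreover have "i \<otimes> v \<in> I" "x \<otimes> j \<in> I"
      using I i j c assms by (auto simp: alg_ideal_def)
    moreover have "x \<otimes> j \<in> carrier A" "x \<otimes> y \<in> carrier A"
      using assms c by (auto intro: mult_closed)
    ultimately show ?thesis by (simp add: coset_eqI)
  qed
  have "(I +> x) \<otimes>\<^bsub>quot_alg A I\<^esub> (I +> y) = (\<Union>u\<in>I +> x. \<Union>v\<in>I +> y. I +> (u \<otimes> v))"
    by (simp add: quot_alg_def ring.defs module.defs FactRing_def rcoset_mult_def)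
  also have "\<dots> = I +> (x \<otimes> y)"
    using eq I.a_rcos_self[OF assms(1)] I.a_rcos_self[OF assms(2)] by blast
  finally show ?thesis .
qed

lemma nonassoc_algebra_quot_alg: "nonassoc_algebra K (quot_alg A I)"
proof -
  have "vectorspace K (quot_alg A I)"
  proof (rule vs_criteria, goal_cases)
    case 1
    show ?case ..
  next
    case 4
    show ?case
    proof
      fix v assume "v \<in> carrier (quot_alg A I)"
      then obtain x where "x \<in> carrier A" "v = I +> x" by (auto simp: quot_carrier)
      then show "\<exists>w\<in>carrier (quot_alg A I). v \<oplus>\<^bsub>quot_alg A I\<^esub> w = \<zero>\<^bsub>quot_alg A I\<^esub>"
        by (intro bexI[of _ "I +> (\<ominus> x)"]) (auto simp: quot_carrier quot_zero quot_add M.r_neg)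
    qed
  qed (auto simp: quot_carrier quot_zero quot_add quot_smult M.a_ac smult_assoc1 smult_l_distr
        smult_r_distr)
  then interpret Q: vectorspace K "quot_alg A I" .
  show ?thesis
    by unfold_locales
      (auto simp: quot_carrier quot_add quot_smult quot_mult mult_closed mult_add_left
        mult_add_right mult_smult_left mult_smult_right)
qed

lemma quot_minus:
  assumes "x \<in> carrier A" "y \<in> carrier A"
  shows "(I +> x) \<ominus>\<^bsub>quot_alg A I\<^esub> (I +> y) = I +> (x \<ominus> y)"
proof -
  interpret Q: nonassoc_algebra K "quot_alg A I" by (rule nonassoc_algebra_quot_alg)
  have "\<ominus>\<^bsub>quot_alg A I\<^esub> (I +> y) = I +> (\<ominus> y)"
    using assms
    by (intro Q.M.minus_equality) (auto simp: quot_carrier quot_zero quot_add M.l_neg)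
  then show ?thesis using assms by (simp add: a_minus_def quot_add)
qed

lemma quot_eqI:
  assumes "x \<in> carrier A" "y \<in> carrier A" "x \<ominus> y \<in> I"
  shows "I +> x = I +> y"
proof -
  have "x = (x \<ominus> y) \<oplus> y"
    using assms(1,2) by (simp add: a_minus_def M.a_assoc M.l_neg)
  then have "I +> x = I +> ((x \<ominus> y) \<oplus> y)" by simp
  also have "\<dots> = I +> y" using assms by (intro coset_eqI)
  finally show ?thesis .
qed

lemma novikov_algebra_quot_alg:
  assumes "novikov_values A \<subseteq> I"
  shows "novikov_algebra K (quot_alg A I)"
proof -
  interpret Q: nonassoc_algebra K "quot_alg A I" by (rule nonassoc_algebra_quot_alg)
  have assoc: "associator (quot_alg A I) (I +> a) (I +> b) (I +> c) = I +> associator A a b c"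
    if "a \<in> carrier A" "b \<in> carrier A" "c \<in> carrier A" for a b c
    using that by (simp add: associator_def quot_mult quot_minus mult_closed)
  have ideal: "associator A a b c \<ominus> associator A a c b \<in> I"
    "(a \<otimes> (b \<otimes> c)) \<ominus> (b \<otimes> (a \<otimes> c)) \<in> I"
    if "a \<in> carrier A" "b \<in> carrier A" "c \<in> carrier A" for a b c
  proof -
    show "associator A a b c \<ominus> associator A a c b \<in> I"
      using that by (intro subsetD[OF assms], unfold novikov_values_def)
        (rule UnI1, rule CollectI, rule exI[of _ a], rule exI[of _ b], rule exI[of _ c], simp)
    show "(a \<otimes> (b \<otimes> c)) \<ominus> (b \<otimes> (a \<otimes> c)) \<in> I"
      using that by (intro subsetD[OF assms], unfold novikov_values_def)
        (rule UnI2, rule CollectI, rule exI[of _ a], rule exI[of _ b], rule exI[of _ c], simp)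
  qed
  show ?thesis
  proof (unfold_locales, goal_cases)
    case (1 x y z)
    then obtain a b c where "a \<in> carrier A" "b \<in> carrier A" "c \<in> carrier A"
      "x = I +> a" "y = I +> b" "z = I +> c" by (auto simp: quot_carrier)
    then show ?case
      using quot_eqI[OF _ _ ideal(1)[of a b c]] by (simp add: assoc associator_closed)
  next
    case (2 x y z)
    then obtain a b c where "a \<in> carrier A" "b \<in> carrier A" "c \<in> carrier A"
      "x = I +> a" "y = I +> b" "z = I +> c" by (auto simp: quot_carrier)
    then show ?case
      using quot_eqI[OF _ _ ideal(2)[of a b c]] by (simp add: quot_mult mult_closed)
  qed
qed

end

end

theorem novikov_algebra_free_novikov:
  "novikov_algebra (class_ring :: 'k::field ring) (free_novikov X :: ('k, _) module)"
proof -
  interpret nonassoc_algebra "class_ring :: 'k ring" "free_nonassoc X :: ('k, _) module"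
    by (rule nonassoc_algebra_free_nonassoc)
  show ?thesis
    unfolding free_novikov_def novikov_ideal_def
    by (rule novikov_algebra_quot_alg[OF alg_ideal_gen_alg_ideal[OF novikov_values_closed]])
      (auto simp: gen_alg_ideal_def)
qed

end

theory Submission
  imports Defs "HOL-Real_Asymp.Real_Asymp"
begin

text \<open>
  In a commutative differential algebra \<open>a \<circ> b = a' b\<close> is a Novikov product, which maps the
  multilinear part of the free Novikov algebra to differential polynomials spanned by the monomials
  \<open>x\<^sub>1\<^bsup>(k\<^sub>1)\<^esup> \<dots> x\<^sub>n\<^bsup>(k\<^sub>n)\<^esup>\<close> with \<open>k\<^sub>1 + \<dots> + k\<^sub>n = n - 1\<close>. There are \<open>2n - 2\<close> choose \<open>n - 1\<close> of these, and
  over every field the map is an isomorphism onto their span, for the following reason.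

  Right symmetry alone gives the symmetric braces of a pre-Lie algebra,
  \<open>x{w, y\<^sub>1, \<dots>, y\<^sub>m} = x{y\<^sub>1, \<dots>, y\<^sub>m} \<circ> w - \<Sum>\<^sub>j x{\<dots>, y\<^sub>j \<circ> w, \<dots>}\<close>, which in the differential model
  evaluate to \<open>x\<^bsup>(m+1)\<^esup> w y\<^sub>1 \<dots> y\<^sub>m\<close>. Left commutativity makes the operators \<open>w \<mapsto> x{w, y\<^sub>1, \<dots>, y\<^sub>m}\<close>
  commute with each other, and together with symmetry this allows the arguments of nested braces to
  be exchanged. So a word of nested braces depends only on the differential monomial it evaluates to,
  and the words are closed under the product up to linear combinations: one word per monomial spans,
  and the differential model shows independence.
\<close>

section \<open>Symmetric braces\<close>

fun brace :: "('a::ab_group_add \<Rightarrow> 'a \<Rightarrow> 'a) \<Rightarrow> 'a \<Rightarrow> 'a list \<Rightarrow> 'a" where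
  "brace mul x [] = x"
| "brace mul x (w # ys) =
     mul (brace mul x ys) w - (\<Sum>j<length ys. brace mul x (ys[j := mul (ys ! j) w]))"

lemma brace_hom:
  assumes "additive h" "\<And>a b. h (mul a b) = mul' (h a) (h b)"
  shows "h (brace mul x ys) = brace mul' (h x) (map h ys)"
proof (induction "length ys" arbitrary: ys)
  case (Suc n)
  then obtain w zs where ys: "ys = w # zs" "length zs = n" by (cases ys) auto
  interpret h: additive h by fact
  show ?case using Suc by (simp add: ys h.diff h.sum assms(2) map_update)
qed simp

lemma mset_list_update:
  "i < length ys \<Longrightarrow> mset (ys[i := a]) = add_mset a (mset (take i ys @ drop (Suc i) ys))"
  by (simp add: upd_conv_take_nth_drop)

text \<open>A rearrangement is a chain of adjacent swaps. Invariance is demanded only on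
  rearrangements of \<open>xs\<close>, because the swap lemmas for words hold only for lists of the
  right length.\<close>

lemma adjacent_swap_invariant:
  assumes "mset xs = mset ys"
    and "\<And>us a b vs. mset (us @ a # b # vs) = mset xs \<Longrightarrow> f (us @ a # b # vs) = f (us @ b # a # vs)"
  shows "f xs = f ys"
proof -
  \<comment> \<open>Bubbles \<open>a\<close> rightwards through \<open>us\<close>; below it carries
    the head of one list to its place in the other.\<close>
  have move: "f (ws @ a # us @ vs) = f (ws @ us @ a # vs)"
    if "mset (ws @ a # us @ vs) = mset xs" for ws a us vs
    using that
  proof (induction us arbitrary: ws)
    case (Cons u us)
    have "f (ws @ a # (u # us) @ vs) = f (ws @ u # a # us @ vs)"
      using Cons.prems assms(2)[of ws a u "us @ vs"] by simp
    also have "\<dots> = f ((ws @ [u]) @ us @ a # vs)"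
      using Cons.IH[of "ws @ [u]"] Cons.prems by (simp add: add_mset_commute[of u a])
    finally show ?case by simp
  qed simp
  have "f (ws @ us) = f (ws @ vs)" if "mset us = mset vs" "mset (ws @ us) = mset xs" for ws us vs
    using that
  proof (induction us arbitrary: ws vs)
    case (Cons u us)
    from Cons.prems have "u \<in> set vs" by (metis list.set_intros(1) set_mset_mset)
    then obtain p q where vs: "vs = p @ u # q" by (metis split_list)
    have "f (ws @ u # us) = f ((ws @ [u]) @ us)" by simp
    also have "\<dots> = f ((ws @ [u]) @ p @ q)"
      using Cons.prems vs by (intro Cons.IH) auto
    also have "\<dots> = f (ws @ vs)"
      using Cons.prems vs move[of ws u p q] by simp
    finally show ?case .
  qed simp
  from this[of xs ys "[]"] assms(1) show ?thesis by simp
qed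

locale biadditive =
  fixes mul :: "'a::ab_group_add \<Rightarrow> 'a \<Rightarrow> 'a" (infixl "\<cdot>" 70)
  assumes add_left: "(a + b) \<cdot> c = a \<cdot> c + b \<cdot> c"
    and add_right: "a \<cdot> (b + c) = a \<cdot> b + a \<cdot> c"
begin

lemma additive_left: "additive (\<lambda>a. a \<cdot> c)"
  by (simp add: additive_def add_left)

lemma additive_right: "additive (\<lambda>b. a \<cdot> b)"
  by (simp add: additive_def add_right)

lemmas diff_left = additive.diff[OF additive_left]
  and sum_left = additive.sum[OF additive_left]

text \<open>Each argument enters every term of the recursion exactly once, as a factor of a product
  or inside a shorter brace, so induction on the length applies.\<close>

lemma brace_add:
  "i < length ys \<Longrightarrow>
    brace (\<cdot>) x (ys[i := a + b]) = brace (\<cdot>) x (ys[i := a]) + brace (\<cdot>) x (ys[i := b])"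
proof (induction "length ys" arbitrary: ys i a b)
  case (Suc n)
  then obtain w zs where ys: "ys = w # zs" and n: "length zs = n" by (cases ys) auto
  note IH = Suc.hyps(1)
  show ?case
  proof (cases i)
    case 0
    have "brace (\<cdot>) x (zs[j := zs ! j \<cdot> (a + b)]) =
        brace (\<cdot>) x (zs[j := zs ! j \<cdot> a]) + brace (\<cdot>) x (zs[j := zs ! j \<cdot> b])" if "j < length zs" for j
      using IH[of zs j] n that by (simp add: add_right)
    then show ?thesis by (simp add: ys 0 add_right sum.distrib)
  next
    case (Suc k)
    then have k: "k < length zs" using Suc.prems ys by simp
    let ?T = "\<lambda>c j. brace (\<cdot>) x (zs[k := c, j := zs[k := c] ! j \<cdot> w])"
    have "?T (a + b) j = ?T a j + ?T b j" if "j < length zs" for j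
    proof (cases "j = k")
      case True
      then show ?thesis using IH[of zs k] n k by (simp add: add_left)
    next
      case False
      then show ?thesis using IH[of "zs[j := zs ! j \<cdot> w]" k] n k by (simp add: list_update_swap)
    qed
    then show ?thesis
      using IH[of zs k] n k by (simp add: ys Suc add_left sum.distrib)
  qed
qed simp

end

locale right_symmetric = biadditive +
  assumes right_symmetric: "a \<cdot> (b \<cdot> c) - (a \<cdot> b) \<cdot> c = a \<cdot> (c \<cdot> b) - (a \<cdot> c) \<cdot> b"
begin

text \<open>The terms are grouped so that each group is symmetric in \<open>v\<close> and
  \<open>w\<close>: the first (a negated associator) and the third by right symmetry, the second
  visibly, the double sum by exchanging \<open>i\<close> and \<open>j\<close>.\<close>

lemma brace_Cons_Cons:
  fixes x v w :: 'a and ys :: "'a list"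
  defines "b \<equiv> brace (\<cdot>) x" and "n \<equiv> length ys"
  shows "b (v # w # ys) =
    ((b ys \<cdot> w) \<cdot> v - b ys \<cdot> (w \<cdot> v))
    - ((\<Sum>i<n. b (ys[i := ys ! i \<cdot> w]) \<cdot> v) + (\<Sum>i<n. b (ys[i := ys ! i \<cdot> v]) \<cdot> w))
    + (\<Sum>i<n. b (ys[i := ys ! i \<cdot> (w \<cdot> v) + (ys ! i \<cdot> v) \<cdot> w]))
    + (\<Sum>i<n. \<Sum>j\<in>{..<n} - {i}. b (ys[i := ys ! i \<cdot> v, j := ys ! j \<cdot> w]))"
proof -
  \<comment> \<open>The diagonal term, where first \<open>v\<close> and then \<open>w\<close> hit
    the same argument, is split off from the sum over \<open>j\<close>.\<close>
  have inner: "b (w # ys[i := ys ! i \<cdot> v]) = b (ys[i := ys ! i \<cdot> v]) \<cdot> w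
      - (b (ys[i := (ys ! i \<cdot> v) \<cdot> w])
        + (\<Sum>j\<in>{..<n} - {i}. b (ys[i := ys ! i \<cdot> v, j := ys ! j \<cdot> w])))" if "i < n" for i
  proof -
    have "(\<Sum>j<n. b (ys[i := ys ! i \<cdot> v, j := ys[i := ys ! i \<cdot> v] ! j \<cdot> w])) =
        b (ys[i := (ys ! i \<cdot> v) \<cdot> w])
        + (\<Sum>j\<in>{..<n} - {i}. b (ys[i := ys ! i \<cdot> v, j := ys[i := ys ! i \<cdot> v] ! j \<cdot> w]))"
      using that by (subst sum.remove[of _ i]) (auto simp: n_def)
    also have "(\<Sum>j\<in>{..<n} - {i}. b (ys[i := ys ! i \<cdot> v, j := ys[i := ys ! i \<cdot> v] ! j \<cdot> w])) =
        (\<Sum>j\<in>{..<n} - {i}. b (ys[i := ys ! i \<cdot> v, j := ys ! j \<cdot> w]))"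
      by (intro sum.cong) auto
    finally show ?thesis by (simp add: b_def n_def)
  qed
  have "b (v # w # ys) = b (w # ys) \<cdot> v - b ((w \<cdot> v) # ys) - (\<Sum>i<n. b (w # ys[i := ys ! i \<cdot> v]))"
    by (simp add: b_def n_def sum.lessThan_Suc_shift del: sum.lessThan_Suc brace.simps(2)
        add: brace.simps(2)[of _ _ v])
  also have "(\<Sum>i<n. b (w # ys[i := ys ! i \<cdot> v])) = (\<Sum>i<n. b (ys[i := ys ! i \<cdot> v]) \<cdot> w)
      - ((\<Sum>i<n. b (ys[i := (ys ! i \<cdot> v) \<cdot> w]))
        + (\<Sum>i<n. \<Sum>j\<in>{..<n} - {i}. b (ys[i := ys ! i \<cdot> v, j := ys ! j \<cdot> w])))"
    by (simp add: inner sum_subtractf sum.distrib)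
  also have "b (w # ys) \<cdot> v = (b ys \<cdot> w) \<cdot> v - (\<Sum>i<n. b (ys[i := ys ! i \<cdot> w]) \<cdot> v)"
    by (simp add: b_def n_def diff_left sum_left)
  also have "b ((w \<cdot> v) # ys) = b ys \<cdot> (w \<cdot> v) - (\<Sum>i<n. b (ys[i := ys ! i \<cdot> (w \<cdot> v)]))"
    by (simp add: b_def n_def)
  also have "(\<Sum>i<n. b (ys[i := ys ! i \<cdot> (w \<cdot> v) + (ys ! i \<cdot> v) \<cdot> w])) =
      (\<Sum>i<n. b (ys[i := ys ! i \<cdot> (w \<cdot> v)])) + (\<Sum>i<n. b (ys[i := (ys ! i \<cdot> v) \<cdot> w]))"
    by (simp add: b_def n_def brace_add sum.distrib)
  ultimately show ?thesis by (simp add: algebra_simps)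
qed

lemma brace_swap: "brace (\<cdot>) x (v # w # ys) = brace (\<cdot>) x (w # v # ys)"
proof -
  have rs: "a \<cdot> (w \<cdot> v) + (a \<cdot> v) \<cdot> w = a \<cdot> (v \<cdot> w) + (a \<cdot> w) \<cdot> v"
    "(a \<cdot> w) \<cdot> v - a \<cdot> (w \<cdot> v) = (a \<cdot> v) \<cdot> w - a \<cdot> (v \<cdot> w)" for a
    using right_symmetric[of a v w] by (simp_all add: algebra_simps)
  have "(\<Sum>i<n. \<Sum>j\<in>{..<n} - {i}. f i j) = (\<Sum>i<n. \<Sum>j\<in>{..<n} - {i}. f j i)"
    for f :: "nat \<Rightarrow> nat \<Rightarrow> 'a" and n
  proof -
    have "(\<Sum>i<n. \<Sum>j\<in>{..<n} - {i}. f i j) = (\<Sum>i<n. \<Sum>j | j \<in> {..<n} \<and> i \<noteq> j. f i j)"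
      by (intro sum.cong) auto
    also have "\<dots> = (\<Sum>j<n. \<Sum>i | i \<in> {..<n} \<and> i \<noteq> j. f i j)"
      by (rule sum.swap_restrict) auto
    also have "\<dots> = (\<Sum>i<n. \<Sum>j\<in>{..<n} - {i}. f j i)"
      by (intro sum.cong) auto
    finally show ?thesis .
  qed
  note swap = this[of "\<lambda>i j. brace (\<cdot>) x (ys[i := ys ! i \<cdot> v, j := ys ! j \<cdot> w])"]
  have upd: "(\<Sum>i<n. \<Sum>j\<in>{..<n} - {i}. brace (\<cdot>) x (ys[j := ys ! j \<cdot> v, i := ys ! i \<cdot> w])) =
      (\<Sum>i<n. \<Sum>j\<in>{..<n} - {i}. brace (\<cdot>) x (ys[i := ys ! i \<cdot> w, j := ys ! j \<cdot> v]))" for n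
    by (intro sum.cong refl) (auto simp: list_update_swap)
  show ?thesis
    unfolding brace_Cons_Cons[of x v w] brace_Cons_Cons[of x w v] rs swap upd
    by (simp add: add.commute)
qed

text \<open>With equal heads the recursion involves only shorter braces, which by induction depend
  on multisets alone. With different heads, each head is moved to second place in the other list and
  \<open>brace_swap\<close> applies.\<close>

lemma brace_perm: "mset ys = mset zs \<Longrightarrow> brace (\<cdot>) x ys = brace (\<cdot>) x zs"
proof (induction "length ys" arbitrary: ys zs)
  case 0
  then show ?case by simp
next
  case (Suc n)
  note IH = Suc.hyps(1)
  have tail: "brace (\<cdot>) x (w # us) = brace (\<cdot>) x (w # vs)"
    if "mset us = mset vs" "length us = n" for w us vs
  proof -
    \<comment> \<open>\<open>g\<close> evaluates the brace at a chosen enumeration of a multiset; at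
      length \<open>n\<close> the induction hypothesis makes the result independent of the
      choice.\<close>
    define g where "g m = brace (\<cdot>) x (SOME l. mset l = m)" for m
    have g: "brace (\<cdot>) x l = g (mset l)" if "length l = n" for l
      unfolding g_def using IH[of l "SOME l'. mset l' = mset l"] that someI[of "\<lambda>l'. mset l' = mset l" l]
      by simp
    have *: "(\<Sum>j<length l. brace (\<cdot>) x (l[j := l ! j \<cdot> w])) =
        (\<Sum>y\<in>#mset l. g (add_mset (y \<cdot> w) (mset l - {#y#})))" if "length l = n" for l
    proof -
      have "(\<Sum>j<length l. brace (\<cdot>) x (l[j := l ! j \<cdot> w])) =
          (\<Sum>j<length l. g (add_mset (l ! j \<cdot> w) (mset l - {#l ! j#})))"
        using that by (intro sum.cong refl) (simp add: g mset_update)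
      also have "\<dots> = (\<Sum>y\<leftarrow>l. g (add_mset (y \<cdot> w) (mset l - {#y#})))"
        by (simp add: sum_list_sum_nth atLeast0LessThan)
      finally show ?thesis by (simp add: sum_mset_sum_list[symmetric])
    qed
    have "length vs = n" using that by (metis size_mset)
    then show ?thesis using that g[of us] g[of vs] *[of us] *[of vs] by simp
  qed
  from Suc obtain w us where ys: "ys = w # us" "length us = n" by (cases ys) auto
  with Suc obtain v vs where zs: "zs = v # vs" by (cases zs) auto
  show ?case
  proof (cases "v = w")
    case True
    then show ?thesis using Suc.prems ys zs tail by simp
  next
    case False
    from Suc.prems ys zs have eq: "add_mset w (mset us) = add_mset v (mset vs)" by simp
    with False obtain R where R: "mset us = add_mset v R" "mset vs = add_mset w R"
      by (metis add_eq_conv_ex)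
    obtain r where r: "mset r = R" by (metis ex_mset)
    have "length vs = n" using arg_cong[OF eq, of size] ys by simp
    then show ?thesis
      using tail[of us "v # r" w] tail[of vs "w # r" v] R r ys zs brace_swap[of x w v r] by simp
  qed
qed

text \<open>\<open>brace_perm\<close> puts the changed argument \<open>y \<cdot> w\<close> in front,
  so every term of the recursion is covered by induction and
  \<open>F (y \<cdot> w) = y \<cdot> F w\<close> moves \<open>F\<close> onto \<open>w\<close>. The
  lemma is applied with left multiplications, braces and scalings as \<open>F\<close>.\<close>

lemma brace_linear_map:
  assumes "additive F" "\<And>a b. F (a \<cdot> b) = a \<cdot> F b"
  shows "F (brace (\<cdot>) x (w # ys)) = brace (\<cdot>) x (F w # ys)"
proof (induction "length ys" arbitrary: ys w rule: less_induct)
  case less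
  interpret F: additive F by fact
  have "F (brace (\<cdot>) x (ys[j := ys ! j \<cdot> w])) = brace (\<cdot>) x (ys[j := ys ! j \<cdot> F w])"
    if "j < length ys" for j
  proof -
    let ?r = "take j ys @ drop (Suc j) ys"
    have p: "brace (\<cdot>) x (ys[j := u]) = brace (\<cdot>) x (u # ?r)" for u
      using that by (intro brace_perm) (simp add: mset_list_update)
    show ?thesis unfolding p using that by (subst less) (auto simp: assms(2))
  qed
  then show ?case by (simp add: F.diff F.sum assms(2))
qed

lemma additive_brace: "additive (\<lambda>f. brace (\<cdot>) x (f # ys))"
  unfolding additive_def using brace_add[of 0 "_ # ys" x] by simp

end

locale novikov = right_symmetric +
  assumes left_commutative: "a \<cdot> (b \<cdot> c) = b \<cdot> (a \<cdot> c)"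
begin

lemma brace_mul: "brace (\<cdot>) x (a \<cdot> w # ys) = a \<cdot> brace (\<cdot>) x (w # ys)"
  using brace_linear_map[OF additive_right left_commutative] by simp

text \<open>By \<open>brace_mul\<close> the operator \<open>f \<mapsto> x{f, ys}\<close> commutes
  with left multiplications, so it is itself an admissible \<open>F\<close> for
  \<open>brace_linear_map\<close>.\<close>

lemma brace_brace: "brace (\<cdot>) x (brace (\<cdot>) v (f # zs) # ys) = brace (\<cdot>) v (brace (\<cdot>) x (f # ys) # zs)"
  using brace_linear_map[OF additive_brace[of x ys] brace_mul] by simp

text \<open>After swapping \<open>f\<close> and \<open>d\<close>, commuting the two braces makes
  \<open>d\<close> and \<open>b\<close> neighbours in one brace; they are swapped there and the
  other steps are undone.\<close>

lemma brace_exchange: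
  "brace (\<cdot>) x (brace (\<cdot>) v (f # d # zs) # b # ys) = brace (\<cdot>) x (brace (\<cdot>) v (f # b # zs) # d # ys)"
  by (metis brace_brace brace_swap)

end

section \<open>Words in a Novikov algebra\<close>

declare brace.simps(2) [simp del]

text \<open>
  A block \<open>(x, k)\<close> stands for the derivative of \<open>x\<close> of order \<open>k + 1\<close>. Words are meaningful only if the
  number of underived variables \<open>zs\<close> is one more than the sum of all \<open>k\<close>.
\<close>

fun word :: "('a::ab_group_add \<Rightarrow> 'a \<Rightarrow> 'a) \<Rightarrow> ('v \<Rightarrow> 'a) \<Rightarrow> ('v \<times> nat) list \<Rightarrow> 'v list \<Rightarrow> 'a" where
  "word mul g [] zs = g (hd zs)"
| "word mul g ((x, k) # bs) zs =
     brace mul (g x) (word mul g bs (drop k zs) # map g (take k zs))"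

lemma word_hom:
  assumes "additive h" "\<And>a b. h (mul a b) = mul' (h a) (h b)"
  shows "h (word mul g bs zs) = word mul' (\<lambda>v. h (g v)) bs zs"
  by (induction bs arbitrary: zs)
    (auto simp: brace_hom[of h mul mul', OF assms] comp_def)

context novikov
begin

text \<open>A block with \<open>k = 0\<close> is a left multiplication and is pulled out by
  \<open>brace_mul\<close>. The first block with \<open>k > 0\<close> has \<open>d\<close> among its
  arguments, where \<open>brace_exchange\<close> applies; without such a block
  \<open>brace_swap\<close> suffices.\<close>

lemma word_exchange:
  "brace (\<cdot>) (g x) (word (\<cdot>) g bs (d # zs) # g b # ys) =
   brace (\<cdot>) (g x) (word (\<cdot>) g bs (b # zs) # g d # ys)"
proof (induction bs arbitrary: zs)
  case Nil
  then show ?case by (simp add: brace_swap)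
next
  case (Cons p bs)
  obtain v l where p: "p = (v, l)" by fastforce
  show ?case
  proof (cases l)
    case 0
    have "word (\<cdot>) g (p # bs) zs' = g v \<cdot> word (\<cdot>) g bs zs'" for zs'
      by (simp add: p 0 brace.simps(2))
    then show ?thesis using Cons by (simp add: brace_mul del: word.simps)
  next
    case (Suc n)
    then show ?thesis by (simp add: p brace_exchange)
  qed
qed

lemma word_swap_zeros:
  "length (us @ a # b # vs) = Suc (sum_list (map snd bs)) \<Longrightarrow>
    word (\<cdot>) g bs (us @ a # b # vs) = word (\<cdot>) g bs (us @ b # a # vs)"
proof (induction bs arbitrary: us vs)
  case (Cons p bs)
  obtain x k where p: "p = (x, k)" by fastforce
  \<comment> \<open>The pair lies behind the first \<open>k\<close> variables, straddles that cut,
    or lies before it. Only the straddling case needs \<open>word_exchange\<close>. For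
    \<open>bs = []\<close> the length condition leaves no room for a pair.\<close>
  consider "k \<le> length us" | "k = Suc (length us)" | "Suc (Suc (length us)) \<le> k"
    by linarith
  then show ?case
  proof cases
    case 1
    then show ?thesis using Cons by (simp add: p)
  next
    case 2
    have "brace (\<cdot>) (g x) (w # map g us @ [g c]) = brace (\<cdot>) (g x) (w # g c # map g us)" for w c
      by (intro brace_perm) simp
    then show ?thesis using 2 by (simp add: p word_exchange[of g x bs b vs a])
  next
    case 3
    then obtain r where "k = Suc (Suc (length us + r))" by (metis add_Suc le_Suc_ex)
    then show ?thesis by (simp add: p) (intro brace_perm, simp)
  qed
qed simp

lemma word_perm_zeros:
  assumes "mset zs = mset zs'" "length zs = Suc (sum_list (map snd bs))"
  shows "word (\<cdot>) g bs zs = word (\<cdot>) g bs zs'"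
  using assms(1)
proof (rule adjacent_swap_invariant)
  fix us a b vs assume "mset (us @ a # b # vs) = mset zs"
  then have "length (us @ a # b # vs) = length zs" by (metis size_mset)
  then show "word (\<cdot>) g bs (us @ a # b # vs) = word (\<cdot>) g bs (us @ b # a # vs)"
    using assms(2) by (intro word_swap_zeros) simp
qed

text \<open>\<open>brace_brace\<close> exchanges two adjacent blocks together with their underived
  variables; \<open>word_perm_zeros\<close> then restores the order of these variables.\<close>

lemma word_swap_blocks:
  "length zs = Suc (sum_list (map snd (us @ a # b # vs))) \<Longrightarrow>
    word (\<cdot>) g (us @ a # b # vs) zs = word (\<cdot>) g (us @ b # a # vs) zs"
proof (induction us arbitrary: zs)
  case Nil
  obtain x k y l where ab: "a = (x, k)" "b = (y, l)" by fastforce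
  let ?K = "take k zs" and ?L = "take l (drop k zs)" and ?R = "drop (k + l) zs"
  have zs: "zs = ?K @ ?L @ ?R" by (metis append_take_drop_id drop_drop add.commute)
  have lens: "length ?K = k" "length ?L = l" using Nil by (auto simp: ab)
  have "word (\<cdot>) g (b # a # vs) zs = word (\<cdot>) g (b # a # vs) (?L @ ?K @ ?R)"
  proof (rule word_perm_zeros)
    show "mset zs = mset (?L @ ?K @ ?R)" by (subst zs) (simp del: append_take_drop_id)
  qed (use Nil in simp)
  also have "\<dots> = brace (\<cdot>) (g y) (brace (\<cdot>) (g x) (word (\<cdot>) g vs ?R # map g ?K) # map g ?L)"
    using lens by (simp add: ab)
  also have "\<dots> = word (\<cdot>) g (a # b # vs) zs"
    by (simp add: ab brace_brace add.commute)
  finally show ?case by simp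
next
  case (Cons u us)
  obtain x k where "u = (x, k)" by fastforce
  then show ?case using Cons by (simp)
qed

lemma word_perm:
  assumes "mset bs = mset bs'" "mset zs = mset zs'" "length zs = Suc (sum_list (map snd bs))"
  shows "word (\<cdot>) g bs zs = word (\<cdot>) g bs' zs'"
proof -
  have "word (\<cdot>) g bs zs' = word (\<cdot>) g bs' zs'"
    using assms(1)
  proof (rule adjacent_swap_invariant)
    fix us a b vs assume "mset (us @ a # b # vs) = mset bs"
    then have "mset (map snd (us @ a # b # vs)) = mset (map snd bs)" by (metis mset_map)
    then have "sum_list (map snd (us @ a # b # vs)) = sum_list (map snd bs)" by (metis sum_mset_sum_list)
    moreover have "length zs' = length zs" using assms(2) by (metis size_mset)
    ultimately show "word (\<cdot>) g (us @ a # b # vs) zs' = word (\<cdot>) g (us @ b # a # vs) zs'"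
      using assms(3) by (intro word_swap_blocks) simp
  qed
  then show ?thesis using word_perm_zeros[OF assms(2,3)] by simp
qed

end

section \<open>Spans of words and their closure under the product\<close>

locale bilinear_algebra = biadditive mul + vector_space scale
  for mul :: "'a::ab_group_add \<Rightarrow> 'a \<Rightarrow> 'a" (infixl "\<cdot>" 70)
    and scale :: "'k::field \<Rightarrow> 'a \<Rightarrow> 'a" (infixr "*s" 75) +
  assumes mul_scale_left: "(c *s a) \<cdot> b = c *s (a \<cdot> b)"
    and mul_scale_right: "a \<cdot> (c *s b) = c *s (a \<cdot> b)"

locale novikov_vector_space = novikov mul + bilinear_algebra mul scale
  for mul :: "'a::ab_group_add \<Rightarrow> 'a \<Rightarrow> 'a" (infixl "\<cdot>" 70)
    and scale :: "'k::field \<Rightarrow> 'a \<Rightarrow> 'a" (infixr "*s" 75)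
begin

definition words :: "('v \<Rightarrow> 'a) \<Rightarrow> 'v multiset \<Rightarrow> 'a set" where
  "words g m = {word (\<cdot>) g bs zs | bs zs.
     mset (map fst bs) + mset zs = m \<and> length zs = Suc (sum_list (map snd bs))}"

lemma map_in_span:
  assumes "u \<in> span S" "additive F" "\<And>c a. F (c *s a) = c *s F a" "\<And>p. p \<in> S \<Longrightarrow> F p \<in> span T"
  shows "F u \<in> span T"
proof -
  interpret F: additive F by fact
  show ?thesis using assms(1)
    by (induction rule: span_induct_alt)
      (auto simp: F.zero F.add assms(3) intro!: span_add span_scale span_zero assms(4))
qed

lemma brace_scale: "brace (\<cdot>) x ((c *s w) # ys) = c *s brace (\<cdot>) x (w # ys)"
  by (subst brace_linear_map[of "\<lambda>a. c *s a"])
    (auto simp: additive_def scale_right_distrib mul_scale_right)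

lemma brace_words_span:
  assumes "u \<in> span (words g m)"
  shows "brace (\<cdot>) (g x) (u # map g ys) \<in> span (words g (add_mset x (m + mset ys)))"
proof (rule map_in_span[OF assms additive_brace brace_scale])
  fix p assume "p \<in> words g m"
  then obtain bs zs where p: "p = word (\<cdot>) g bs zs" "mset (map fst bs) + mset zs = m"
    "length zs = Suc (sum_list (map snd bs))" by (auto simp: words_def)
  have "brace (\<cdot>) (g x) (p # map g ys) = word (\<cdot>) g ((x, length ys) # bs) (ys @ zs)"
    by (simp add: p(1))
  moreover have "\<dots> \<in> words g (add_mset x (m + mset ys))"
    unfolding words_def mem_Collect_eq using p(2,3)
    by (intro exI[of _ "(x, length ys) # bs"] exI[of _ "ys @ zs"]) (auto simp: ac_simps)
  ultimately show "brace (\<cdot>) (g x) (p # map g ys) \<in> span (words g (add_mset x (m + mset ys)))"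
    by (auto intro: span_base)
qed

text \<open>\<open>brace_brace\<close> pulls the outer block of the word out of the brace, which
  leaves a brace of the same shape over a shorter word. At the end the word is one generator and
  joins \<open>ys\<close>.\<close>

lemma brace_two_words_span:
  assumes "length zs = Suc (sum_list (map snd bs))" "v \<in> span (words g m)"
  shows "brace (\<cdot>) (g x) (word (\<cdot>) g bs zs # v # map g ys) \<in>
    span (words g (add_mset x (mset (map fst bs) + mset zs + m + mset ys)))"
  using assms(1)
proof (induction bs arbitrary: zs)
  case Nil
  then obtain z where z: "zs = [z]" by (auto simp: length_Suc_conv)
  show ?case using brace_words_span[OF assms(2), of x "z # ys"]
    by (simp add: z brace_swap[of _ "g z"] ac_simps)
next
  case (Cons p bs)
  obtain y k where p: "p = (y, k)" by fastforce
  have zs: "mset zs = mset (take k zs) + mset (drop k zs)"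
    by (metis append_take_drop_id mset_append)
  have "brace (\<cdot>) (g x) (word (\<cdot>) g (p # bs) zs # v # map g ys) =
      brace (\<cdot>) (g y) (brace (\<cdot>) (g x) (word (\<cdot>) g bs (drop k zs) # v # map g ys) # map g (take k zs))"
    by (simp add: p brace_brace)
  also have "\<dots> \<in> span (words g (add_mset y
      (add_mset x (mset (map fst bs) + mset (drop k zs) + m + mset ys) + mset (take k zs))))"
    using Cons.prems by (intro brace_words_span Cons.IH) (simp add: p)
  finally show ?case by (simp add: p zs ac_simps add_mset_commute[of x])
qed

text \<open>The brace recursion, solved for the product, writes \<open>x{q, ys} \<cdot> v\<close> as
  \<open>x{v, q, ys}\<close> plus the braces in which \<open>v\<close> multiplies \<open>q\<close>
  or one of the \<open>ys\<close>. The induction keeps \<open>v\<close> arbitrary because it is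
  applied to a brace containing \<open>v\<close>.\<close>

lemma word_mul_span:
  assumes "length zs = Suc (sum_list (map snd bs))" "v \<in> span (words g m)"
  shows "word (\<cdot>) g bs zs \<cdot> v \<in> span (words g (mset (map fst bs) + mset zs + m))"
  using assms
proof (induction bs arbitrary: zs v m)
  case Nil
  then obtain z where z: "zs = [z]" by (auto simp: length_Suc_conv)
  show ?case using brace_words_span[OF Nil(2), of z "[]"] by (simp add: z brace.simps(2))
next
  case (Cons p bs)
  obtain x k where p: "p = (x, k)" by fastforce
  let ?ys = "map g (take k zs)" and ?q = "word (\<cdot>) g bs (drop k zs)"
  let ?m = "mset (map fst (p # bs)) + mset zs + m"
  have zs: "mset zs = mset (take k zs) + mset (drop k zs)"
    by (metis append_take_drop_id mset_append)
  have len: "length (drop k zs) = Suc (sum_list (map snd bs))" using Cons.prems by (simp add: p)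
  have "word (\<cdot>) g (p # bs) zs \<cdot> v = brace (\<cdot>) (g x) (v # ?q # ?ys)
      + (\<Sum>j<Suc (length ?ys). brace (\<cdot>) (g x) ((?q # ?ys)[j := (?q # ?ys) ! j \<cdot> v]))"
    by (simp add: p brace.simps(2)[of _ _ v] del: sum.lessThan_Suc)
  also have "\<dots> = brace (\<cdot>) (g x) (v # ?q # ?ys) + (brace (\<cdot>) (g x) (?q \<cdot> v # ?ys)
      + (\<Sum>j<length ?ys. brace (\<cdot>) (g x) (?q # ?ys[j := ?ys ! j \<cdot> v])))"
    by (simp add: sum.lessThan_Suc_shift del: sum.lessThan_Suc)
  also have "\<dots> \<in> span (words g ?m)"
  proof (intro span_add span_sum)
    show "brace (\<cdot>) (g x) (v # ?q # ?ys) \<in> span (words g ?m)"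
      using brace_two_words_span[OF len Cons.prems(2), of x "take k zs"]
      by (simp add: brace_swap[of _ v] p zs ac_simps)
    \<comment> \<open>Left commutativity turns \<open>x{q \<cdot> v, ys}\<close> into
      \<open>q \<cdot> x{v, ys}\<close>, a product with a shorter word on the left.\<close>
    have "?q \<cdot> brace (\<cdot>) (g x) (v # ?ys) \<in>
        span (words g (mset (map fst bs) + mset (drop k zs) + add_mset x (m + mset (take k zs))))"
      by (intro Cons.IH len brace_words_span Cons.prems)
    then show "brace (\<cdot>) (g x) (?q \<cdot> v # ?ys) \<in> span (words g ?m)"
      by (simp add: brace_mul p zs ac_simps)
    fix j assume "j \<in> {..<length ?ys}"
    then have j: "j < length (take k zs)" by simp
    let ?y = "take k zs ! j" and ?r = "take j (take k zs) @ drop (Suc j) (take k zs)"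
    have r: "mset (take k zs) = add_mset ?y (mset ?r)"
      using mset_list_update[OF j, of ?y] by simp
    \<comment> \<open>The changed argument is moved to the front so that the generator
      \<open>g ?y\<close> can be pulled out; as a left multiplication it is a block with
      \<open>k = 0\<close>.\<close>
    have "brace (\<cdot>) (g x) (?q # ?ys[j := ?ys ! j \<cdot> v]) = brace (\<cdot>) (g x) (g ?y \<cdot> v # ?q # map g ?r)"
      using j mset_list_update[of j ?ys "g ?y \<cdot> v"]
      by (intro brace_perm) (simp add: take_map drop_map)
    also have "\<dots> = brace (\<cdot>) (g ?y) (brace (\<cdot>) (g x) (?q # v # map g ?r) # map g [])"
      by (simp add: brace_mul brace_swap[of _ v]) (simp add: brace.simps(2))
    also have "\<dots> \<in> span (words g (add_mset ?y
        (add_mset x (mset (map fst bs) + mset (drop k zs) + m + mset ?r) + mset [])))"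
      by (intro brace_words_span brace_two_words_span len Cons.prems)
    finally show "brace (\<cdot>) (g x) (?q # ?ys[j := ?ys ! j \<cdot> v]) \<in> span (words g ?m)"
      unfolding zs r by (simp add: p ac_simps)
  qed
  finally show ?case .
qed

lemma mul_words_span:
  assumes "u \<in> span (words g l)" "v \<in> span (words g m)"
  shows "u \<cdot> v \<in> span (words g (l + m))"
proof (rule map_in_span[OF assms(1) additive_left mul_scale_left])
  fix p assume "p \<in> words g l"
  then show "p \<cdot> v \<in> span (words g (l + m))"
    using word_mul_span[OF _ assms(2)] by (auto simp: words_def)
qed

end

section \<open>Differential polynomials\<close>

definition pscale :: "'k::field \<Rightarrow> ('a \<Rightarrow>\<^sub>0 'k) \<Rightarrow> ('a \<Rightarrow>\<^sub>0 'k)" where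
  "pscale c = Poly_Mapping.map ((*) c)"

lemma lookup_pscale [simp]: "Poly_Mapping.lookup (pscale c f) t = c * Poly_Mapping.lookup f t"
  by (simp add: pscale_def Poly_Mapping.map.rep_eq when_def)

lemma pscale_single: "pscale c (Poly_Mapping.single t a) = Poly_Mapping.single t (c * a)"
  by (rule poly_mapping_eqI) (simp add: lookup_single when_def)

interpretation pm: vector_space "pscale :: 'k::field \<Rightarrow> ('a \<Rightarrow>\<^sub>0 'k) \<Rightarrow> _"
  by unfold_locales (auto intro!: poly_mapping_eqI simp: lookup_add algebra_simps)

lemma sum_pscale_single:
  assumes "finite S" "Poly_Mapping.keys f \<subseteq> S"
  shows "f = (\<Sum>t\<in>S. pscale (Poly_Mapping.lookup f t) (Poly_Mapping.single t 1))"
proof (rule poly_mapping_eqI)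
  fix u
  have "Poly_Mapping.lookup (\<Sum>t\<in>S. pscale (Poly_Mapping.lookup f t) (Poly_Mapping.single t 1)) u =
      (\<Sum>t\<in>S. if t = u then Poly_Mapping.lookup f u else 0)"
    unfolding lookup_sum by (intro sum.cong) (auto simp: lookup_single)
  also have "\<dots> = Poly_Mapping.lookup f u"
    using assms by (auto simp: sum.delta in_keys_iff)
  finally show "Poly_Mapping.lookup f u =
      Poly_Mapping.lookup (\<Sum>t\<in>S. pscale (Poly_Mapping.lookup f t) (Poly_Mapping.single t 1)) u" ..
qed

definition linear_extension ::
  "('k::field \<Rightarrow> 'a \<Rightarrow> 'a::ab_group_add) \<Rightarrow> ('t \<Rightarrow> 'a) \<Rightarrow> ('t \<Rightarrow>\<^sub>0 'k) \<Rightarrow> 'a" where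
  "linear_extension scale h f = (\<Sum>t\<in>Poly_Mapping.keys f. scale (Poly_Mapping.lookup f t) (h t))"

context vector_space
begin

lemma linear_extension_superset:
  fixes f :: "'t \<Rightarrow>\<^sub>0 'a"
  shows "finite S \<Longrightarrow> Poly_Mapping.keys f \<subseteq> S \<Longrightarrow>
    linear_extension scale h f = (\<Sum>t\<in>S. scale (Poly_Mapping.lookup f t) (h t))"
  unfolding linear_extension_def by (rule sum.mono_neutral_left) (auto simp: in_keys_iff)

lemma linear_extension_add: "linear_extension scale h (f + g) = linear_extension scale h f + linear_extension scale h g"
proof -
  let ?S = "Poly_Mapping.keys f \<union> Poly_Mapping.keys g"
  have "Poly_Mapping.keys (f + g) \<subseteq> ?S" by (rule keys_add)
  then show ?thesis
    by (simp add: linear_extension_superset[of ?S] lookup_add scale_left_distrib sum.distrib)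
qed

lemma additive_linear_extension: "additive (linear_extension scale h)"
  by (simp add: additive_def linear_extension_add)

lemma linear_extension_scale: "linear_extension scale h (pscale c f) = scale c (linear_extension scale h f)"
proof -
  have "Poly_Mapping.keys (pscale c f) \<subseteq> Poly_Mapping.keys f" by (auto simp: in_keys_iff)
  then show ?thesis
    by (simp add: linear_extension_superset[of "Poly_Mapping.keys f"] scale_sum_right)
qed

lemma linear_extension_single: "linear_extension scale h (Poly_Mapping.single t c) = scale c (h t)"
  by (simp add: linear_extension_def)

end

context bilinear_algebra
begin

primrec eval_monom :: "('v \<Rightarrow> 'a) \<Rightarrow> 'v nonassoc_monom \<Rightarrow> 'a" where
  "eval_monom g (Gen v) = g v"
| "eval_monom g (Mul s t) = eval_monom g s \<cdot> eval_monom g t"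

text \<open>The universal property of the free nonassociative algebra: evaluating the generators
  extends to a homomorphism. It serves both \<open>restrict_gens\<close> and
  \<open>diff_eval\<close>.\<close>

lemma linear_extension_mult:
  "linear_extension scale (eval_monom g) (nonassoc_mult p q) =
    linear_extension scale (eval_monom g) p \<cdot> linear_extension scale (eval_monom g) q"
proof -
  let ?h = "linear_extension scale (eval_monom g)"
  interpret h: additive ?h by (rule additive_linear_extension)
  have "?h (nonassoc_mult p q) = (\<Sum>s\<in>Poly_Mapping.keys p. \<Sum>t\<in>Poly_Mapping.keys q.
      (Poly_Mapping.lookup p s *s eval_monom g s) \<cdot> (Poly_Mapping.lookup q t *s eval_monom g t))"
    by (simp add: nonassoc_mult_def h.sum linear_extension_single mul_scale_left mul_scale_right mult.commute)
  also have "\<dots> = ?h p \<cdot> ?h q"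
    by (subst sum.swap) (simp add: linear_extension_def additive.sum[OF additive_left] additive.sum[OF additive_right])
  finally show ?thesis .
qed

end

lemma biadditive_nonassoc_mult: "biadditive (nonassoc_mult :: ('v nonassoc_monom \<Rightarrow>\<^sub>0 'k::field) \<Rightarrow> _)"
  by unfold_locales
    (auto intro!: poly_mapping_eqI simp: lookup_add algebra_simps split: nonassoc_monom.split)

text \<open>A pair \<open>(v, k)\<close> stands for the \<open>k\<close>-th derivative of the variable \<open>v\<close>.\<close>

type_synonym ('v, 'k) diff_poly = "('v \<times> nat) multiset \<Rightarrow>\<^sub>0 'k"

text \<open>The sum counts repeated factors with multiplicity, which yields the coefficients of the
  power rule.\<close>

definition deriv_monom :: "('v \<times> nat) multiset \<Rightarrow> ('v, 'k::field) diff_poly" where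
  "deriv_monom m =
     (\<Sum>p\<in>#m. Poly_Mapping.single (add_mset (fst p, Suc (snd p)) (m - {#p#})) 1)"

definition deriv :: "('v, 'k::field) diff_poly \<Rightarrow> ('v, 'k) diff_poly" where
  "deriv = linear_extension pscale deriv_monom"

lemma deriv_monom_add:
  "(deriv_monom (l + m) :: ('v, 'k::field) diff_poly) =
    deriv_monom l * Poly_Mapping.single m 1 + Poly_Mapping.single l 1 * deriv_monom m"
proof -
  let ?s = "\<lambda>m. Poly_Mapping.single m (1::'k)"
  have "(\<Sum>p\<in>#l. ?s (add_mset (fst p, Suc (snd p)) (l + m - {#p#}))) =
      (\<Sum>p\<in>#l. ?s (add_mset (fst p, Suc (snd p)) (l - {#p#})) * ?s m)"
    by (intro arg_cong[of _ _ sum_mset] image_mset_cong) (simp add: mult_single)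
  moreover have "(\<Sum>p\<in>#m. ?s (add_mset (fst p, Suc (snd p)) (l + m - {#p#}))) =
      (\<Sum>p\<in>#m. ?s l * ?s (add_mset (fst p, Suc (snd p)) (m - {#p#})))"
    by (intro arg_cong[of _ _ sum_mset] image_mset_cong) (simp add: mult_single)
  ultimately show ?thesis
    by (simp add: deriv_monom_def sum_mset_distrib_left sum_mset_distrib_right image_mset.compositionality comp_def)
qed

lemma additive_deriv: "additive deriv"
  unfolding deriv_def by (rule pm.additive_linear_extension)

lemma deriv_pscale: "deriv (pscale c f) = pscale c (deriv f)"
  unfolding deriv_def by (rule pm.linear_extension_scale)

lemma deriv_single_1: "deriv (Poly_Mapping.single m 1) = deriv_monom m"
  by (simp add: deriv_def pm.linear_extension_single)

lemma pscale_mult: "pscale c f * g = pscale c (f * g)" "f * pscale c g = pscale c (f * g)"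
  for f g :: "'a::comm_monoid_add \<Rightarrow>\<^sub>0 'k::field"
  by (simp_all add: pscale_def mult_map_scale_conv_mult mult_ac)

text \<open>The rule passes from monomials to polynomials one factor at a time: \<open>lin\<close>
  frees the left factor, commutativity exchanges the factors, and \<open>lin\<close> is used
  again.\<close>

lemma deriv_mult: "deriv (f * g) = deriv f * g + f * deriv g"
  for f g :: "('v, 'k::field) diff_poly"
proof -
  interpret D: additive deriv by (rule additive_deriv)
  let ?P = "\<lambda>f g :: ('v, 'k) diff_poly. deriv (f * g) = deriv f * g + f * deriv g"
  have lin: "?P f g" if P: "\<And>m. ?P (Poly_Mapping.single m 1) g" for f g
  proof -
    define F where "F = (\<Sum>m\<in>Poly_Mapping.keys f. pscale (Poly_Mapping.lookup f m) (Poly_Mapping.single m 1))"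
    have "?P F g"
      by (simp add: F_def sum_distrib_right D.sum pscale_mult deriv_pscale P pm.scale_right_distrib
          sum.distrib)
    moreover have "F = f" by (simp add: F_def sum_pscale_single[symmetric])
    ultimately show ?thesis by simp
  qed
  have "?P (Poly_Mapping.single l 1) (Poly_Mapping.single m 1)" for l m
    by (simp add: mult_single deriv_single_1 deriv_monom_add)
  then have "?P f (Poly_Mapping.single m 1)" for f m by (rule lin)
  then have "?P (Poly_Mapping.single m 1) f" for f m
    by (simp add: mult.commute add.commute)
  then show ?thesis by (rule lin)
qed

definition nov_diff :: "('v, 'k::field) diff_poly \<Rightarrow> ('v, 'k) diff_poly \<Rightarrow> ('v, 'k) diff_poly" where
  "nov_diff f g = deriv f * g"

abbreviation dvar :: "'v \<Rightarrow> nat \<Rightarrow> ('v, 'k::field) diff_poly" where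
  "dvar v k \<equiv> Poly_Mapping.single {#(v, k)#} 1"

text \<open>The associator \<open>(a, b, c)\<close> equals \<open>- a'' b c\<close>, symmetric in
  \<open>b\<close> and \<open>c\<close>, and \<open>a \<circ> (b \<circ> c) = a' b' c\<close> is
  symmetric in \<open>a\<close> and \<open>b\<close>.\<close>

interpretation nov_diff: novikov_vector_space "nov_diff :: ('v, 'k::field) diff_poly \<Rightarrow> _" pscale
  by unfold_locales
    (simp_all add: nov_diff_def deriv_mult additive.add[OF additive_deriv] deriv_pscale pscale_mult algebra_simps)

lemma deriv_prod_list: "deriv (prod_list fs) = (\<Sum>j<length fs. prod_list (fs[j := deriv (fs ! j)]))"
proof (induction fs)
  case Nil
  show ?case using deriv_single_1[of "{#}"] by (simp add: deriv_monom_def)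
next
  case (Cons f fs)
  then show ?case
    by (simp add: deriv_mult sum.lessThan_Suc_shift sum_distrib_left del: sum.lessThan_Suc)
qed

text \<open>The subtracted terms are exactly the Leibniz terms that differentiate an argument, so
  only the derivative of the factor \<open>dvar v n\<close> survives.\<close>

lemma brace_nov_diff: "brace nov_diff (dvar v 0) fs = dvar v (length fs) * prod_list fs"
proof (induction "length fs" arbitrary: fs)
  case (Suc n)
  then obtain w gs where fs: "fs = w # gs" and n: "length gs = n" by (cases fs) auto
  have upd: "prod_list (gs[j := a * w]) = prod_list (gs[j := a]) * w" if "j < length gs" for j a
    using that by (simp add: upd_conv_take_nth_drop mult_ac)
  have "brace nov_diff (dvar v 0) fs =
      deriv (dvar v n * prod_list gs) * w - (\<Sum>j<n. dvar v n * (prod_list (gs[j := deriv (gs ! j)]) * w))"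
    using Suc.hyps(1) n by (simp add: fs brace.simps(2) nov_diff_def upd)
  also have "\<dots> = deriv (dvar v n) * prod_list gs * w"
    by (simp add: deriv_mult deriv_prod_list n sum_distrib_left sum_distrib_right algebra_simps)
  also have "deriv (dvar v n) = dvar v (Suc n)"
    by (simp add: deriv_single_1 deriv_monom_def)
  finally show ?case by (simp add: fs n mult_ac)
qed simp

lemma word_nov_diff:
  "length zs = Suc (sum_list (map snd bs)) \<Longrightarrow> word nov_diff (\<lambda>v. dvar v 0) bs zs =
    Poly_Mapping.single (mset (map (\<lambda>(x, k). (x, Suc k)) bs) + mset (map (\<lambda>z. (z, 0)) zs)) 1"
proof (induction bs arbitrary: zs)
  case Nil
  then obtain z where "zs = [z]" by (auto simp: length_Suc_conv)
  then show ?case by simp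
next
  case (Cons p bs)
  obtain x k where p: "p = (x, k)" by fastforce
  have prod: "prod_list (map (\<lambda>v. dvar v 0) vs) = Poly_Mapping.single (mset (map (\<lambda>z. (z, 0)) vs)) 1"
    for vs :: "'a list"
    by (induction vs) (simp_all add: mult_single)
  have "mset (map (\<lambda>z. (z, 0::nat)) zs) =
      mset (map (\<lambda>z. (z, 0)) (take k zs)) + mset (map (\<lambda>z. (z, 0)) (drop k zs))"
    by (metis append_take_drop_id mset_append map_append)
  then show ?case using Cons by (simp add: p brace_nov_diff prod mult_single ac_simps)
qed

text \<open>Here \<open>(x, k)\<close> is the \<open>k\<close>-th derivative of \<open>x\<close>,
  whereas a block \<open>(x, k)\<close> of a word stands for order \<open>k + 1\<close>; hence the
  shift to \<open>k - 1\<close> and the separate treatment of order 0.\<close>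

definition monom_word :: "('a::ab_group_add \<Rightarrow> 'a \<Rightarrow> 'a) \<Rightarrow> ('v \<Rightarrow> 'a) \<Rightarrow> ('v \<times> nat) list \<Rightarrow> 'a" where
  "monom_word mul g L = word mul g (map (\<lambda>(x, k). (x, k - 1)) (filter (\<lambda>p. snd p \<noteq> 0) L))
     (map fst (filter (\<lambda>p. snd p = 0) L))"

lemma monom_word_admissible:
  assumes "length L = Suc (sum_list (map snd L))"
  shows "length (map fst (filter (\<lambda>p. snd p = 0) L)) =
    Suc (sum_list (map snd (map (\<lambda>(x, k). (x, k - 1)) (filter (\<lambda>p. snd p \<noteq> 0) L))))"
proof -
  \<comment> \<open>An entry of order 0 contributes 1 to both sides, an entry of order
    \<open>k > 0\<close> contributes \<open>k = (k - 1) + 1\<close>.\<close>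
  have "length (filter (\<lambda>p. snd p = 0) L) + sum_list (map snd L) =
      sum_list (map snd (map (\<lambda>(x, k). (x, k - 1)) (filter (\<lambda>p. snd p \<noteq> 0) L))) + length L"
    for L :: "('a \<times> nat) list"
    by (induction L) auto
  from this[of L] assms show ?thesis by simp
qed

lemma monom_word_nov_diff:
  assumes "length L = Suc (sum_list (map snd L))"
  shows "monom_word nov_diff (\<lambda>v. dvar v 0) L = Poly_Mapping.single (mset L) 1"
proof -
  have "mset (map (\<lambda>(x, k). (x, Suc k)) (map (\<lambda>(x, k). (x, k - 1)) (filter (\<lambda>p. snd p \<noteq> 0) L)))
      + mset (map (\<lambda>z. (z, 0)) (map fst (filter (\<lambda>p. snd p = 0) L))) = mset L"
    by (induction L) auto
  then show ?thesis
    unfolding monom_word_def by (subst word_nov_diff[OF monom_word_admissible[OF assms]]) simp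
qed

lemma (in novikov) monom_word_perm:
  assumes "mset L = mset L'" "length L = Suc (sum_list (map snd L))"
  shows "monom_word (\<cdot>) g L = monom_word (\<cdot>) g L'"
  unfolding monom_word_def
  by (rule word_perm[OF _ _ monom_word_admissible[OF assms(2)]])
    (simp_all add: assms(1) mset_filter)

lemma (in novikov_vector_space) words_subset:
  "words g m \<subseteq> {monom_word (\<cdot>) g L | L. mset (map fst L) = m \<and> length L = Suc (sum_list (map snd L))}"
proof
  fix p assume "p \<in> words g m"
  then obtain bs zs where p: "p = word (\<cdot>) g bs zs" "mset (map fst bs) + mset zs = m"
    "length zs = Suc (sum_list (map snd bs))" by (auto simp: words_def)
  let ?L = "map (\<lambda>(x, k). (x, Suc k)) bs @ map (\<lambda>z. (z, 0)) zs"
  have "map (\<lambda>(x, k). (x, k - 1)) (filter (\<lambda>p. snd p \<noteq> 0) ?L) = bs"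
    "filter (\<lambda>p. snd p = 0) ?L = map (\<lambda>z. (z, 0)) zs"
    by (auto simp: filter_map comp_def case_prod_unfold)
  then have "p = monom_word (\<cdot>) g ?L" by (simp add: p(1) monom_word_def comp_def)
  moreover have "mset (map fst ?L) = m"
    by (simp add: p(2)[symmetric] comp_def case_prod_unfold image_mset.compositionality)
  moreover have "length ?L = Suc (sum_list (map snd ?L))"
    using p(3) by (simp add: comp_def case_prod_unfold sum_list_Suc)
  ultimately show "p \<in> {monom_word (\<cdot>) g L | L. mset (map fst L) = m \<and> length L = Suc (sum_list (map snd L))}"
    by blast
qed

text \<open>Sorting by variable gives a normal form of the monomial in which only the list of
  derivative orders remains as data.\<close>

lemma mset_zip_ex:
  fixes L :: "(nat \<times> nat) list"
  assumes "mset (map fst L) = mset xs" "sorted xs"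
  obtains l where "length l = length xs" "sum_list l = sum_list (map snd L)" "mset L = mset (zip xs l)"
proof
  let ?S = "sort_key fst L"
  have "map fst ?S = xs" using assms
    by (metis properties_for_sort mset_map mset_sort sorted_sort_key sorted_sort_id)
  then have "?S = zip xs (map snd ?S)" by (metis zip_map_fst_snd)
  then show "mset L = mset (zip xs (map snd ?S))" by (metis mset_sort)
  show "length (map snd ?S) = length xs" using \<open>map fst ?S = xs\<close> by (metis length_map)
  show "sum_list (map snd ?S) = sum_list (map snd L)"
    by (metis mset_map mset_sort sum_mset_sum_list)
qed

section \<open>The free Novikov algebra\<close>

text \<open>A basis of \<open>S\<close> is extended to the whole space, and \<open>p\<close> kills
  the part from \<open>S\<close> and fixes the rest. This models the quotient by \<open>S\<close>
  inside the original type, whose addition the algebra locales above use.\<close>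

lemma (in vector_space) projection_along_subspace:
  assumes "subspace S"
  obtains p where "additive p" "\<And>c x. p (scale c x) = scale c (p x)"
    "\<And>x. p x - x \<in> S" "\<And>x. p x = 0 \<longleftrightarrow> x \<in> S"
proof -
  interpret vector_space_pair scale scale ..
  obtain B where B: "B \<subseteq> S" "independent B" "S \<subseteq> span B"
    using maximal_independent_subset[of S] by blast
  let ?C = "extend_basis B"
  obtain p where lin: "Vector_Spaces.linear scale scale p" and p: "\<And>b. b \<in> ?C \<Longrightarrow> p b = (if b \<in> B then 0 else b)"
    using linear_independent_extend[OF independent_extend_basis[OF B(2)], of "\<lambda>b. if b \<in> B then 0 else b"]
    by auto
  interpret p: Vector_Spaces.linear scale scale p by fact
  have diff: "p x - x \<in> S" for x
  proof -
    have "x \<in> span ?C" using span_extend_basis[OF B(2)] by simp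
    then show ?thesis
    proof (induction rule: span_induct_alt)
      case base
      then show ?case by (simp add: p.zero subspace_0 assms)
    next
      case (step c x y)
      have "p x - x \<in> S" using p step(1) B(1) subspace_neg[OF assms] subspace_0[OF assms] by auto
      moreover have eq: "p (scale c x + y) - (scale c x + y) = scale c (p x - x) + (p y - y)"
        by (simp add: p.add p.scale scale_right_diff_distrib)
      ultimately show ?case unfolding eq by (intro subspace_add subspace_scale assms step)
    qed
  qed
  have zero: "p x = 0" if "x \<in> S" for x
  proof -
    have "x \<in> span B" using that B(3) by blast
    then show ?thesis
      by (induction rule: span_induct_alt)
        (use p extend_basis_superset[OF B(2)] in \<open>auto simp: p.add p.scale p.zero\<close>)
  qed
  show ?thesis
  proof (rule that)
    show "additive p" by (simp add: additive_def p.add)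
    show "p x = 0 \<longleftrightarrow> x \<in> S" for x
      using zero diff[of x] subspace_neg[OF assms, of "- x"] by auto
  qed (use diff p.scale in auto)
qed

interpretation free: bilinear_algebra "nonassoc_mult :: ('v nonassoc_monom \<Rightarrow>\<^sub>0 'k::field) \<Rightarrow> _" pscale
proof -
  interpret biadditive "nonassoc_mult :: ('v nonassoc_monom \<Rightarrow>\<^sub>0 'k) \<Rightarrow> _"
    by (rule biadditive_nonassoc_mult)
  show "bilinear_algebra (nonassoc_mult :: ('v nonassoc_monom \<Rightarrow>\<^sub>0 'k) \<Rightarrow> _) pscale"
    by unfold_locales (auto intro!: poly_mapping_eqI split: nonassoc_monom.split)
qed

abbreviation fgen :: "'v \<Rightarrow> ('v nonassoc_monom \<Rightarrow>\<^sub>0 'k::field)" where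
  "fgen v \<equiv> Poly_Mapping.single (Gen v) 1"

lemma nonassoc_mult_single:
  "nonassoc_mult (Poly_Mapping.single s a) (Poly_Mapping.single t b) = Poly_Mapping.single (Mul s t) (a * b)"
  by (rule poly_mapping_eqI) (auto simp: lookup_single when_def split: nonassoc_monom.split)

text \<open>Multidegree, with 0 homogeneous of every degree. It locates the words in the multilinear
  part and hence over the generators \<open>1, ..., n\<close>.\<close>

definition homogeneous :: "'v multiset \<Rightarrow> ('v nonassoc_monom \<Rightarrow>\<^sub>0 'k::field) \<Rightarrow> bool" where
  "homogeneous m f \<longleftrightarrow> (\<forall>t. Poly_Mapping.lookup f t \<noteq> 0 \<longrightarrow> gens t = m)"

lemma homogeneous_mult:
  "homogeneous l f \<Longrightarrow> homogeneous m g \<Longrightarrow> homogeneous (l + m) (nonassoc_mult f g)"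
  by (auto simp: homogeneous_def split: nonassoc_monom.split)

lemma homogeneous_diff: "homogeneous m f \<Longrightarrow> homogeneous m g \<Longrightarrow> homogeneous m (f - g)"
  unfolding homogeneous_def lookup_minus by (metis diff_self)

lemma homogeneous_sum: "(\<And>i. i \<in> I \<Longrightarrow> homogeneous m (f i)) \<Longrightarrow> homogeneous m (sum f I)"
  unfolding homogeneous_def lookup_sum by (metis sum.neutral)

text \<open>Every term of the brace recursion contains \<open>x\<close> and each argument exactly
  once.\<close>

lemma homogeneous_brace:
  assumes "homogeneous l x" "list_all2 homogeneous ms ys"
  shows "homogeneous (l + sum_list ms) (brace nonassoc_mult x ys)"
  using assms(2)
proof (induction "length ys" arbitrary: ms ys)
  case 0
  then show ?case using assms(1) by simp
next
  case (Suc n)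
  then obtain m ms' w zs where eq: "ms = m # ms'" "ys = w # zs" "homogeneous m w"
    "list_all2 homogeneous ms' zs" "length zs = n"
    by (cases ys; cases ms) auto
  have len: "length ms' = n" using eq by (metis list_all2_lengthD)
  have "homogeneous (l + sum_list ms' + m) (brace nonassoc_mult x (zs[j := nonassoc_mult (zs ! j) w]))"
    if j: "j < length zs" for j
  proof -
    have "list_all2 homogeneous (ms'[j := ms' ! j + m]) (zs[j := nonassoc_mult (zs ! j) w])"
      using j eq len by (intro list_all2_update_cong homogeneous_mult) (auto dest: list_all2_nthD2)
    moreover have "sum_list (ms'[j := ms' ! j + m]) = sum_list ms' + m"
      using j eq(5) len
      by (subst (3) id_take_nth_drop[of j ms']) (simp_all add: upd_conv_take_nth_drop ac_simps)
    ultimately show ?thesis using Suc.hyps(1)[of "zs[j := nonassoc_mult (zs ! j) w]"] eq(5)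
      by (metis add.assoc length_list_update)
  qed
  moreover have "homogeneous (l + sum_list ms' + m) (nonassoc_mult (brace nonassoc_mult x zs) w)"
    using Suc.hyps(1)[of zs ms'] eq by (intro homogeneous_mult) auto
  ultimately show ?case
    by (auto simp: eq brace.simps(2) ac_simps intro!: homogeneous_diff homogeneous_sum)
qed

lemma homogeneous_fgen: "homogeneous {#v#} (fgen v)"
  by (simp add: homogeneous_def lookup_single when_def)

lemma homogeneous_word:
  defines "g \<equiv> fgen :: 'v \<Rightarrow> ('v nonassoc_monom \<Rightarrow>\<^sub>0 'k::field)"
  shows "length zs = Suc (sum_list (map snd bs)) \<Longrightarrow>
    homogeneous (mset (map fst bs) + mset zs) (word nonassoc_mult g bs zs)"
proof (induction bs arbitrary: zs)
  case Nil
  then obtain z where "zs = [z]" by (auto simp: length_Suc_conv)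
  then show ?case by (simp add: homogeneous_fgen g_def)
next
  case (Cons p bs)
  obtain x k where p: "p = (x, k)" by fastforce
  let ?m = "mset (map fst bs) + mset (drop k zs)"
  have "homogeneous ?m (word nonassoc_mult g bs (drop k zs))"
    using Cons.IH[of "drop k zs"] Cons.prems by (simp add: p)
  moreover have "list_all2 homogeneous (map (\<lambda>v. {#v#}) vs) (map g vs)" for vs :: "'v list"
    by (simp add: list_all2_map1 list_all2_map2 homogeneous_fgen g_def list.rel_refl)
  ultimately have "homogeneous ({#x#} + sum_list (?m # map (\<lambda>v. {#v#}) (take k zs)))
      (word nonassoc_mult g (p # bs) zs)"
    unfolding p word.simps by (intro homogeneous_brace) (simp_all add: homogeneous_fgen g_def)
  moreover have "sum_list (map (\<lambda>v. {#v#}) vs) = mset vs" for vs :: "'v list"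
    by (induction vs) simp_all
  moreover have "mset zs = mset (take k zs) + mset (drop k zs)"
    by (metis append_take_drop_id mset_append)
  ultimately show ?case by (simp add: p ac_simps)
qed

lemma homogeneous_monom_word:
  assumes "length L = Suc (sum_list (map snd L))"
  shows "homogeneous (mset (map fst L)) (monom_word nonassoc_mult fgen L)"
proof -
  have "mset (map fst (map (\<lambda>(x, k). (x, k - 1)) (filter (\<lambda>p. snd p \<noteq> 0) L)))
      + mset (map fst (filter (\<lambda>p. snd p = 0) L)) = mset (map fst L)"
    by (induction L) auto
  then show ?thesis
    unfolding monom_word_def using homogeneous_word[OF monom_word_admissible[OF assms]] by simp
qed

section \<open>The Novikov ideal in terms of the operations on the polynomial type\<close>

lemma free_nonassoc_minus:
  assumes "f \<in> carrier (free_nonassoc X)" "g \<in> carrier (free_nonassoc X :: ('k::field, _) module)"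
  shows "f \<ominus>\<^bsub>free_nonassoc X\<^esub> g = f - g"
proof -
  interpret nonassoc_algebra "class_ring :: 'k ring" "free_nonassoc X :: ('k, _) module"
    by (rule nonassoc_algebra_free_nonassoc)
  have "\<ominus>\<^bsub>free_nonassoc X\<^esub> g = - g"
    using assms by (intro M.minus_equality) auto
  then show ?thesis by (simp add: a_minus_def)
qed

lemma alg_ideal_free_iff:
  fixes I :: "('v nonassoc_monom \<Rightarrow>\<^sub>0 'k::field) set"
  shows "alg_ideal (class_ring :: 'k ring) (free_nonassoc X) I \<longleftrightarrow>
    I \<subseteq> carrier (free_nonassoc X) \<and> pm.subspace I \<and>
    (\<forall>i\<in>I. \<forall>a\<in>carrier (free_nonassoc X :: ('k, _) module). nonassoc_mult a i \<in> I \<and> nonassoc_mult i a \<in> I)"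
proof -
  interpret nonassoc_algebra "class_ring :: 'k ring" "free_nonassoc X :: ('k, 'v nonassoc_monom \<Rightarrow>\<^sub>0 'k) module"
    by (rule nonassoc_algebra_free_nonassoc)
  show ?thesis
    using vectorspace_axioms module_axioms
    unfolding alg_ideal_def VectorSpace.subspace_def LinearCombinations.submodule_def pm.subspace_def
      pscale_def[symmetric] free_nonassoc_simps(2-)
    by auto
qed

lemma alg_ideal_novikov_ideal:
  "alg_ideal (class_ring :: 'k::field ring) (free_nonassoc X)
    (novikov_ideal X :: ('v nonassoc_monom \<Rightarrow>\<^sub>0 'k) set)"
proof -
  interpret nonassoc_algebra "class_ring :: 'k ring" "free_nonassoc X :: ('k, 'v nonassoc_monom \<Rightarrow>\<^sub>0 'k) module"
    by (rule nonassoc_algebra_free_nonassoc)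
  show ?thesis unfolding novikov_ideal_def by (rule alg_ideal_gen_alg_ideal[OF novikov_values_closed])
qed

lemma novikov_values_free:
  "novikov_values (free_nonassoc X :: ('k::field, 'v nonassoc_monom \<Rightarrow>\<^sub>0 'k) module) =
     {(nonassoc_mult a (nonassoc_mult b c) - nonassoc_mult (nonassoc_mult a b) c)
       - (nonassoc_mult a (nonassoc_mult c b) - nonassoc_mult (nonassoc_mult a c) b) | a b c.
       a \<in> carrier (free_nonassoc X :: ('k, _) module) \<and> b \<in> carrier (free_nonassoc X :: ('k, _) module)
         \<and> c \<in> carrier (free_nonassoc X :: ('k, _) module)}
   \<union> {nonassoc_mult a (nonassoc_mult b c) - nonassoc_mult b (nonassoc_mult a c) | a b c.
       a \<in> carrier (free_nonassoc X :: ('k, _) module) \<and> b \<in> carrier (free_nonassoc X :: ('k, _) module)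
         \<and> c \<in> carrier (free_nonassoc X :: ('k, _) module)}"
proof -
  let ?A = "free_nonassoc X :: ('k, 'v nonassoc_monom \<Rightarrow>\<^sub>0 'k) module"
  interpret nonassoc_algebra "class_ring :: 'k ring" ?A
    by (rule nonassoc_algebra_free_nonassoc)
  have mult: "nonassoc_mult f g \<in> carrier ?A" if "f \<in> carrier ?A" "g \<in> carrier ?A" for f g
    using mult_closed[OF that] by simp
  have assoc: "associator ?A a b c = nonassoc_mult a (nonassoc_mult b c) - nonassoc_mult (nonassoc_mult a b) c"
    if "a \<in> carrier ?A" "b \<in> carrier ?A" "c \<in> carrier ?A" for a b c
    unfolding associator_def free_nonassoc_simps(2) using that by (intro free_nonassoc_minus mult)
  have vals: "associator ?A a b c \<ominus>\<^bsub>?A\<^esub> associator ?A a c b =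
      (nonassoc_mult a (nonassoc_mult b c) - nonassoc_mult (nonassoc_mult a b) c)
       - (nonassoc_mult a (nonassoc_mult c b) - nonassoc_mult (nonassoc_mult a c) b)"
    if "a \<in> carrier ?A" "b \<in> carrier ?A" "c \<in> carrier ?A" for a b c
    unfolding assoc[OF that, symmetric] assoc[OF that(1,3,2), symmetric]
    by (intro free_nonassoc_minus associator_closed that)
  have comm: "(a \<otimes>\<^bsub>?A\<^esub> (b \<otimes>\<^bsub>?A\<^esub> c)) \<ominus>\<^bsub>?A\<^esub> (b \<otimes>\<^bsub>?A\<^esub> (a \<otimes>\<^bsub>?A\<^esub> c)) =
      nonassoc_mult a (nonassoc_mult b c) - nonassoc_mult b (nonassoc_mult a c)"
    if "a \<in> carrier ?A" "b \<in> carrier ?A" "c \<in> carrier ?A" for a b c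
    unfolding free_nonassoc_simps(2) using that by (intro free_nonassoc_minus mult)
  show ?thesis
    unfolding novikov_values_def
    by (intro arg_cong2[of _ _ _ _ "(\<union>)"] Collect_cong ex_cong1)
      (auto simp: vals comm simp del: free_nonassoc_simps)
qed

lemma novikov_values_subset: "novikov_values (free_nonassoc X) \<subseteq> novikov_ideal X"
  by (auto simp: novikov_ideal_def gen_alg_ideal_def)

text \<open>The retraction onto the subalgebra over \<open>X\<close>, killing all other generators.
  It serves to extend the ideal from that subalgebra to all polynomials.\<close>

definition restrict_gens :: "'v set \<Rightarrow> ('v nonassoc_monom \<Rightarrow>\<^sub>0 'k::field) \<Rightarrow> ('v nonassoc_monom \<Rightarrow>\<^sub>0 'k)" where
  "restrict_gens X = linear_extension pscale (free.eval_monom (\<lambda>v. if v \<in> X then fgen v else 0))"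

lemma lookup_restrict_gens [simp]:
  fixes f :: "'v nonassoc_monom \<Rightarrow>\<^sub>0 'k::field"
  shows "Poly_Mapping.lookup (restrict_gens X f) t =
    (if set_mset (gens t) \<subseteq> X then Poly_Mapping.lookup f t else 0)"
proof -
  have "free.eval_monom (\<lambda>v. if v \<in> X then fgen v else 0) s =
      (if set_mset (gens s) \<subseteq> X then Poly_Mapping.single s (1::'k) else 0)" for s
    by (induction s) (auto simp: nonassoc_mult_single additive.zero[OF free.additive_left]
        additive.zero[OF free.additive_right])
  then have "Poly_Mapping.lookup (restrict_gens X f) t =
      (\<Sum>s\<in>Poly_Mapping.keys f. if s = t then if set_mset (gens t) \<subseteq> X then Poly_Mapping.lookup f t else 0 else 0)"
    unfolding restrict_gens_def linear_extension_def lookup_sum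
    by (intro sum.cong) (auto simp: lookup_single)
  then show ?thesis by (simp add: sum.delta in_keys_iff)
qed

lemma restrict_gens_closed: "restrict_gens X f \<in> carrier (free_nonassoc X)"
  by simp

lemma restrict_gens_id: "f \<in> carrier (free_nonassoc X) \<Longrightarrow> restrict_gens X f = f"
  by (rule poly_mapping_eqI) auto

lemma restrict_gens_mult:
  "restrict_gens X (nonassoc_mult f g) = nonassoc_mult (restrict_gens X f) (restrict_gens X g)"
  unfolding restrict_gens_def by (rule free.linear_extension_mult)

text \<open>
  A linear projection along the (extended) ideal carries the quotient product back to the whole
  type of polynomials, so that the free Novikov algebra can be studied without cosets.
\<close>

lemma novikov_quotient_model:
  fixes X :: "'v set"
  obtains p :: "('v nonassoc_monom \<Rightarrow>\<^sub>0 'k::field) \<Rightarrow> _" where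
    "additive p" "\<And>c f. p (pscale c f) = pscale c (p f)"
    "\<And>f g. p (nonassoc_mult f g) = p (nonassoc_mult (p f) (p g))"
    "\<And>f. f \<in> carrier (free_nonassoc X :: ('k, _) module) \<Longrightarrow> p f = 0 \<Longrightarrow> f \<in> novikov_ideal X"
    "novikov_vector_space (\<lambda>f g. p (nonassoc_mult f g)) pscale"
proof -
  let ?J = "novikov_ideal X :: ('v nonassoc_monom \<Rightarrow>\<^sub>0 'k) set"
  let ?r = "restrict_gens X :: ('v nonassoc_monom \<Rightarrow>\<^sub>0 'k) \<Rightarrow> _"
  \<comment> \<open>The preimage of the ideal under the retraction meets the carrier in the ideal
    itself and absorbs products with arbitrary polynomials.\<close>
  define S where "S = {f. ?r f \<in> ?J}"
  have J: "pm.subspace ?J"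
    "\<And>i a. i \<in> ?J \<Longrightarrow> a \<in> carrier (free_nonassoc X :: ('k, _) module) \<Longrightarrow> nonassoc_mult a i \<in> ?J \<and> nonassoc_mult i a \<in> ?J"
    using alg_ideal_novikov_ideal[of X, where 'k = 'k] unfolding alg_ideal_free_iff by auto
  interpret r: additive ?r unfolding restrict_gens_def by (rule pm.additive_linear_extension)
  have r_scale: "?r (pscale c f) = pscale c (?r f)" for c f
    unfolding restrict_gens_def by (rule pm.linear_extension_scale)
  have "pm.subspace S"
    using J(1) unfolding pm.subspace_def by (simp add: S_def r.zero r.add r_scale)
  then obtain p where p: "additive p" "\<And>c f. p (pscale c f) = pscale c (p f)"
    "\<And>f. p f - f \<in> S" "\<And>f. p f = 0 \<longleftrightarrow> f \<in> S"
    using pm.projection_along_subspace by blast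
  interpret p: additive p by fact
  have S_mult: "nonassoc_mult a i \<in> S" "nonassoc_mult i a \<in> S" if "i \<in> S" for a i
    using that J(2)[of "?r i" "?r a"] restrict_gens_closed by (auto simp: S_def restrict_gens_mult)
  have p_eq: "p f = p g" if "f - g \<in> S" for f g
    using that p(4)[of "f - g"] by (simp add: p.diff)
  have p_right: "p (nonassoc_mult f (p g)) = p (nonassoc_mult f g)" for f g
    using S_mult(1)[OF p(3), of f g] by (intro p_eq) (simp add: additive.diff[OF free.additive_right])
  have p_left: "p (nonassoc_mult (p f) g) = p (nonassoc_mult f g)" for f g
    using S_mult(2)[OF p(3), of f g] by (intro p_eq) (simp add: free.diff_left)
  \<comment> \<open>The retraction is multiplicative, so it maps the identities at arbitrary
    arguments to values at arguments over \<open>X\<close>.\<close>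
  have vals: "f \<in> S" if "?r f \<in> novikov_values (free_nonassoc X)" for f
    using that novikov_values_subset by (auto simp: S_def)
  have rs: "p ((nonassoc_mult a (nonassoc_mult b c) - nonassoc_mult (nonassoc_mult a b) c)
      - (nonassoc_mult a (nonassoc_mult c b) - nonassoc_mult (nonassoc_mult a c) b)) = 0" for a b c
    unfolding p(4)
    by (rule vals, unfold novikov_values_free r.diff restrict_gens_mult)
      (use restrict_gens_closed in blast)
  have lc: "p (nonassoc_mult a (nonassoc_mult b c) - nonassoc_mult b (nonassoc_mult a c)) = 0" for a b c
    unfolding p(4)
    by (rule vals, unfold novikov_values_free r.diff restrict_gens_mult)
      (use restrict_gens_closed in blast)
  show ?thesis
  proof (rule that[OF p(1,2)])
    show "p (nonassoc_mult f g) = p (nonassoc_mult (p f) (p g))" for f g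
      by (simp add: p_left p_right)
    show "f \<in> ?J" if "f \<in> carrier (free_nonassoc X :: ('k, _) module)" "p f = 0" for f
      using that p(4)[of f] restrict_gens_id[OF that(1)] by (simp add: S_def)
    show "novikov_vector_space (\<lambda>f g. p (nonassoc_mult f g)) pscale"
    proof unfold_locales
      show "p (nonassoc_mult a (p (nonassoc_mult b c))) - p (nonassoc_mult (p (nonassoc_mult a b)) c) =
          p (nonassoc_mult a (p (nonassoc_mult c b))) - p (nonassoc_mult (p (nonassoc_mult a c)) b)" for a b c
        using rs[of a b c] by (simp add: p_left p_right p.diff)
      show "p (nonassoc_mult a (p (nonassoc_mult b c))) = p (nonassoc_mult b (p (nonassoc_mult a c)))" for a b c
        using lc[of a b c] by (simp add: p_right p.diff)
    qed (simp_all add: free.add_left free.add_right p.add free.mul_scale_left free.mul_scale_right p(2))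
  qed
qed

text \<open>Coefficients are indexed by \<open>I\<close>, not by the image, since \<open>f\<close>
  may fail to be injective: distinctness of the basis words in the quotient is not yet known where
  this is applied.\<close>

lemma (in vector_space) span_image_finite:
  assumes "finite I" "x \<in> span (f ` I)"
  shows "\<exists>c. x = (\<Sum>i\<in>I. scale (c i) (f i))"
  using assms(2)
proof (induction rule: span_induct_alt)
  case base
  show ?case by (rule exI[of _ "\<lambda>_. 0"]) simp
next
  case (step a y z)
  then obtain j c where j: "j \<in> I" "y = f j" and z: "z = (\<Sum>i\<in>I. scale (c i) (f i))" by auto
  have "(\<Sum>i\<in>I. scale (if i = j then a else 0) (f i)) = (\<Sum>i\<in>I. if i = j then scale a (f i) else 0)"
    by (intro sum.cong) auto
  also have "\<dots> = scale a y" using assms(1) j by simp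
  finally have "scale a y + z = (\<Sum>i\<in>I. scale ((if i = j then a else 0) + c i) (f i))"
    by (simp add: z scale_left_distrib sum.distrib)
  then show ?case by (rule exI[of _ "\<lambda>i. (if i = j then a else 0) + c i"])
qed

text \<open>A generator is a word without blocks, and products stay in the span by
  \<open>mul_words_span\<close>.\<close>

lemma (in novikov_vector_space) eval_monom_in_span_words:
  "eval_monom g t \<in> span (words g (gens t))"
proof (induction t)
  case (Gen v)
  have "g v \<in> words g {#v#}"
    unfolding words_def by (intro CollectI exI[of _ "[]"] exI[of _ "[v]"]) simp
  then show ?case by (simp add: span_base)
next
  case (Mul s t)
  then show ?case by (simp add: mul_words_span)
qed

section \<open>Basis words span the multilinear part modulo the ideal\<close>

definition diff_orders :: "nat \<Rightarrow> nat list set" where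
  "diff_orders n = {l. length l = n \<and> sum_list l = n - 1}"

text \<open>Stars and bars: \<open>n - 1\<close> derivations are distributed over \<open>n\<close>
  variables.\<close>

lemma card_diff_orders: "n \<ge> 1 \<Longrightarrow> card (diff_orders n) = (2 * n - 2) choose (n - 1)"
  unfolding diff_orders_def card_length_sum_list by (simp add: mult_2 numeral_2_eq_2)

lemma finite_diff_orders: "n \<ge> 1 \<Longrightarrow> finite (diff_orders n)"
  using card_diff_orders[of n] by (intro card_ge_0_finite) simp

definition basis_word :: "nat \<Rightarrow> nat list \<Rightarrow> (nat nonassoc_monom \<Rightarrow>\<^sub>0 'k::field)" where
  "basis_word n l = monom_word nonassoc_mult fgen (zip [1..<Suc n] l)"

lemma zip_diff_orders:
  assumes "n \<ge> 1" "l \<in> diff_orders n"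
  shows "length (zip [1..<Suc n] l) = Suc (sum_list (map snd (zip [1..<Suc n] l)))"
    "map fst (zip [1..<Suc n] l) = [1..<Suc n]"
  using assms by (auto simp: diff_orders_def simp del: upt_Suc)

lemma multilinear_monoms_iff:
  "finite X \<Longrightarrow> t \<in> multilinear_monoms X \<longleftrightarrow> gens t = mset_set X"
proof
  assume X: "finite X" "t \<in> multilinear_monoms X"
  show "gens t = mset_set X"
  proof (rule multiset_eqI)
    show "count (gens t) x = count (mset_set X) x" for x
      using X by (cases "x \<in> X") (auto simp: multilinear_monoms_def not_in_iff[symmetric])
  qed
next
  assume "finite X" "gens t = mset_set X"
  then show "t \<in> multilinear_monoms X" by (simp add: multilinear_monoms_def)
qed

lemma homogeneous_basis_word:
  assumes "n \<ge> 1" "l \<in> diff_orders n"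
  shows "homogeneous (mset_set {1..n}) (basis_word n l :: _ \<Rightarrow>\<^sub>0 'k::field)"
proof -
  have "mset [1..<Suc n] = mset_set {1..n}"
    by (metis atLeastLessThanSuc_atLeastAtMost mset_upt)
  then show ?thesis
    using homogeneous_monom_word[OF zip_diff_orders(1)[OF assms]]
    unfolding basis_word_def zip_diff_orders(2)[OF assms] by simp
qed

lemma monom_in_span_basis_words:
  assumes n: "n \<ge> 1" and t: "t \<in> multilinear_monoms {1..n}"
  shows "\<exists>c. Poly_Mapping.single t (1::'k::field) - (\<Sum>l\<in>diff_orders n. pscale (c l) (basis_word n l))
    \<in> novikov_ideal {1..n}"
proof -
  obtain p :: "(nat nonassoc_monom \<Rightarrow>\<^sub>0 'k) \<Rightarrow> _" where p: "additive p"
    "\<And>c f. p (pscale c f) = pscale c (p f)"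
    "\<And>f g. p (nonassoc_mult f g) = p (nonassoc_mult (p f) (p g))"
    "\<And>f. f \<in> carrier (free_nonassoc {1..n} :: ('k, _) module) \<Longrightarrow> p f = 0 \<Longrightarrow> f \<in> novikov_ideal {1..n}"
    "novikov_vector_space (\<lambda>f g. p (nonassoc_mult f g)) pscale"
    using that by (rule novikov_quotient_model[of "{1..n}"])
  let ?mul = "\<lambda>f g. p (nonassoc_mult f g)"
  let ?g = "\<lambda>v. p (fgen v)"
  interpret p: additive p by fact
  interpret q: novikov_vector_space ?mul pscale by fact
  have gens: "gens t = mset_set {1..n}" using t by (simp add: multilinear_monoms_iff)
  \<comment> \<open>A word depends only on the multiset of its derivative pairs, so its variables
    may be sorted as \<open>1, ..., n\<close>; it is then the image of a basis word under
    \<open>p\<close>.\<close>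
  have sub: "q.words ?g (gens t) \<subseteq> (\<lambda>l. p (basis_word n l)) ` diff_orders n"
  proof
    fix w assume "w \<in> q.words ?g (gens t)"
    then obtain L where L: "w = monom_word ?mul ?g L" "mset (map fst L) = gens t"
      "length L = Suc (sum_list (map snd L))" using q.words_subset by blast
    have "mset (map fst L) = mset [1..<Suc n]"
      unfolding L(2) gens by (metis atLeastLessThanSuc_atLeastAtMost mset_upt)
    then obtain l where l: "length l = n" "sum_list l = sum_list (map snd L)"
      "mset L = mset (zip [1..<Suc n] l)"
      by (rule mset_zip_ex) (simp_all del: upt_Suc)
    have "length L = n"
      using l(1) arg_cong[OF l(3), of size] by (simp del: upt_Suc)
    then have "l \<in> diff_orders n" using l L(3) by (simp add: diff_orders_def)
    moreover have "w = monom_word ?mul ?g (zip [1..<Suc n] l)"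
      unfolding L(1) by (rule q.monom_word_perm[OF l(3) L(3)])
    then have "w = p (basis_word n l)"
      unfolding basis_word_def monom_word_def by (simp add: word_hom[of p nonassoc_mult ?mul, OF p(1,3)])
    ultimately show "w \<in> (\<lambda>l. p (basis_word n l)) ` diff_orders n" by blast
  qed
  have "q.eval_monom ?g s = p (Poly_Mapping.single s 1)" for s
    by (induction s) (simp_all add: p(3)[symmetric] nonassoc_mult_single)
  then have "p (Poly_Mapping.single t 1) \<in> pm.span (q.words ?g (gens t))"
    using q.eval_monom_in_span_words[of ?g t] by simp
  then have "p (Poly_Mapping.single t 1) \<in> pm.span ((\<lambda>l. p (basis_word n l)) ` diff_orders n)"
    using pm.span_mono[OF sub] by blast
  then obtain c where c: "p (Poly_Mapping.single t 1) = (\<Sum>l\<in>diff_orders n. pscale (c l) (p (basis_word n l)))"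
    using pm.span_image_finite[OF finite_diff_orders[OF n]] by blast
  let ?d = "Poly_Mapping.single t 1 - (\<Sum>l\<in>diff_orders n. pscale (c l) (basis_word n l))"
  \<comment> \<open>The kernel of \<open>p\<close> is known to lie in the ideal only within the
    carrier over \<open>1, ..., n\<close>; homogeneity places \<open>?d\<close> there.\<close>
  have "homogeneous (mset_set {1..n}) (pscale (c l) (basis_word n l))" if "l \<in> diff_orders n" for l
    using homogeneous_basis_word[OF n that, where 'k = 'k] by (simp add: homogeneous_def)
  then have "homogeneous (mset_set {1..n}) ?d"
    using gens by (intro homogeneous_diff homogeneous_sum) (auto simp: homogeneous_def lookup_single when_def)
  then have "?d \<in> carrier (free_nonassoc {1..n})"
    by (auto simp: homogeneous_def)
  moreover have "p ?d = 0" by (simp add: p.diff p.sum p(2) c)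
  ultimately show ?thesis using p(4) by blast
qed

section \<open>Independence through the differential model\<close>

definition diff_eval :: "('v nonassoc_monom \<Rightarrow>\<^sub>0 'k::field) \<Rightarrow> ('v, 'k) diff_poly" where
  "diff_eval = linear_extension pscale (nov_diff.eval_monom (\<lambda>v. dvar v 0))"

lemma diff_eval_mult: "diff_eval (nonassoc_mult f g) = nov_diff (diff_eval f) (diff_eval g)"
  unfolding diff_eval_def by (rule nov_diff.linear_extension_mult)

lemma additive_diff_eval: "additive diff_eval"
  unfolding diff_eval_def by (rule pm.additive_linear_extension)

lemma diff_eval_pscale: "diff_eval (pscale c f) = pscale c (diff_eval f)"
  unfolding diff_eval_def by (rule pm.linear_extension_scale)

lemma subspace_free_carrier:
  "pm.subspace (carrier (free_nonassoc X :: ('k::field, 'v nonassoc_monom \<Rightarrow>\<^sub>0 'k) module))"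
  unfolding pm.subspace_def
proof (intro conjI ballI allI)
  fix f g :: "'v nonassoc_monom \<Rightarrow>\<^sub>0 'k"
  assume fg: "f \<in> carrier (free_nonassoc X :: ('k, _) module)" "g \<in> carrier (free_nonassoc X :: ('k, _) module)"
  have "set_mset (gens t) \<subseteq> X" if "Poly_Mapping.lookup (f + g) t \<noteq> 0" for t
    using fg that by (cases "Poly_Mapping.lookup f t = 0") (simp_all add: lookup_add)
  then show "f + g \<in> carrier (free_nonassoc X :: ('k, _) module)" by simp
qed simp_all

text \<open>Within the carrier, the kernel of \<open>diff_eval\<close> is an ideal, and it contains
  all values of the identities because the differential model is Novikov. Hence it contains the
  ideal they generate.\<close>

lemma diff_eval_novikov_ideal:
  fixes f :: "'v nonassoc_monom \<Rightarrow>\<^sub>0 'k::field"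
  assumes "f \<in> novikov_ideal X"
  shows "diff_eval f = 0"
proof -
  interpret d: additive "diff_eval :: ('v nonassoc_monom \<Rightarrow>\<^sub>0 'k) \<Rightarrow> _" by (rule additive_diff_eval)
  let ?A = "free_nonassoc X :: ('k, 'v nonassoc_monom \<Rightarrow>\<^sub>0 'k) module"
  interpret nonassoc_algebra "class_ring :: 'k ring" ?A by (rule nonassoc_algebra_free_nonassoc)
  let ?I = "{f \<in> carrier ?A. diff_eval f = 0}"
  have A: "pm.subspace (carrier ?A)" "\<And>a b. a \<in> carrier ?A \<Longrightarrow> b \<in> carrier ?A \<Longrightarrow> nonassoc_mult a b \<in> carrier ?A"
    by (rule subspace_free_carrier) (use mult_closed in \<open>simp only: free_nonassoc_simps(2)\<close>)
  have "alg_ideal (class_ring :: 'k ring) ?A ?I"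
    unfolding alg_ideal_free_iff
  proof (intro conjI ballI)
    show "?I \<subseteq> carrier ?A" by (rule Collect_restrict)
    show "pm.subspace ?I"
      using A(1) unfolding pm.subspace_def
      by (simp del: free_nonassoc_simps(1) add: d.zero d.add diff_eval_pscale)
    fix i a assume i: "i \<in> ?I" and a: "a \<in> carrier ?A"
    have zero: "nov_diff h 0 = 0" "nov_diff 0 h = 0" for h :: "('v, 'k) diff_poly"
      by (simp_all add: additive.zero[OF nov_diff.additive_left] additive.zero[OF nov_diff.additive_right])
    show "nonassoc_mult a i \<in> ?I" "nonassoc_mult i a \<in> ?I"
      using i A(2)[OF a, of i] A(2)[OF _ a, of i]
      by (simp_all only: mem_Collect_eq diff_eval_mult zero simp_thms)
  qed
  moreover have "novikov_values ?A \<subseteq> ?I"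
  proof
    fix f assume f: "f \<in> novikov_values ?A"
    then consider a b c where
        "f = (nonassoc_mult a (nonassoc_mult b c) - nonassoc_mult (nonassoc_mult a b) c)
          - (nonassoc_mult a (nonassoc_mult c b) - nonassoc_mult (nonassoc_mult a c) b)"
      | a b c where "f = nonassoc_mult a (nonassoc_mult b c) - nonassoc_mult b (nonassoc_mult a c)"
      unfolding novikov_values_free by blast
    then have "diff_eval f = 0"
    proof cases
      case (1 a b c)
      then show ?thesis
        using nov_diff.right_symmetric[of "diff_eval a" "diff_eval b" "diff_eval c"]
        by (simp only: d.diff diff_eval_mult) simp
    next
      case (2 a b c)
      then show ?thesis
        using nov_diff.left_commutative[of "diff_eval a" "diff_eval b" "diff_eval c"]
        by (simp only: d.diff diff_eval_mult) simp
    qed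
    then show "f \<in> ?I" using f novikov_values_closed by blast
  qed
  ultimately show ?thesis
    using assms unfolding novikov_ideal_def gen_alg_ideal_def by blast
qed

lemma diff_eval_basis_word:
  assumes "n \<ge> 1" "l \<in> diff_orders n"
  shows "diff_eval (basis_word n l) = Poly_Mapping.single (mset (zip [1..<Suc n] l)) (1::'k::field)"
proof -
  have "diff_eval (fgen v) = (dvar v 0 :: (nat, 'k) diff_poly)" for v
    by (simp add: diff_eval_def pm.linear_extension_single)
  then have "diff_eval (basis_word n l) =
      (monom_word nov_diff (\<lambda>v. dvar v 0) (zip [1..<Suc n] l) :: (nat, 'k) diff_poly)"
    unfolding basis_word_def monom_word_def
    by (subst word_hom[of diff_eval nonassoc_mult nov_diff, OF additive_diff_eval diff_eval_mult]) simp
  then show ?thesis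
    using monom_word_nov_diff[OF zip_diff_orders(1)[OF assms]] by simp
qed

text \<open>With distinct keys the pairs form the graph of a map, from which the list is read
  off.\<close>

lemma inj_on_mset_zip:
  assumes "distinct xs"
  shows "inj_on (\<lambda>l. mset (zip xs l)) {l. length l = length xs}"
proof (rule inj_onI, clarsimp)
  fix k l :: "'b list"
  assume len: "length k = length xs" "length l = length xs" and eq: "mset (zip xs k) = mset (zip xs l)"
  have "map_of (zip xs k) = map_of (zip xs l)"
    using assms len eq by (intro map_of_inject_set[THEN iffD2]) (auto dest: mset_eq_setD)
  then show "k = l"
    using assms len by (metis map_of_zip_inject)
qed

text \<open>The differential model sends distinct basis words to distinct monomials, so
  \<open>c l\<close> is a coefficient of the zero polynomial.\<close>

lemma basis_words_independent:
  assumes n: "n \<ge> 1"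
    and ideal: "(\<Sum>l\<in>diff_orders n. pscale (c l) (basis_word n l)) \<in> novikov_ideal {1..n}"
    and l: "l \<in> diff_orders n"
  shows "c l = (0::'k::field)"
proof -
  interpret d: additive "diff_eval :: (nat nonassoc_monom \<Rightarrow>\<^sub>0 'k) \<Rightarrow> _" by (rule additive_diff_eval)
  let ?m = "\<lambda>l. mset (zip [1..<Suc n] l)"
  have inj: "inj_on ?m (diff_orders n)"
    by (rule inj_on_subset[OF inj_on_mset_zip]) (auto simp: diff_orders_def simp del: upt_Suc)
  have "(\<Sum>l\<in>diff_orders n. Poly_Mapping.single (?m l) (c l)) = 0"
    using diff_eval_novikov_ideal[OF ideal] diff_eval_basis_word[OF n, where 'k = 'k]
    by (simp add: d.sum diff_eval_pscale pscale_single del: upt_Suc)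
  then have "0 = Poly_Mapping.lookup (\<Sum>l\<in>diff_orders n. Poly_Mapping.single (?m l) (c l)) (?m l)"
    by simp
  also have "\<dots> = (\<Sum>l'\<in>diff_orders n. if l' = l then c l else 0)"
    unfolding lookup_sum lookup_single when_def
    using inj_on_eq_iff[OF inj _ l] by (intro sum.cong) auto
  also have "\<dots> = c l" using l finite_diff_orders[OF n] by simp
  finally show ?thesis by simp
qed

section \<open>The codimensions\<close>

lemma central_binomial_Suc:
  "(m + 1) * ((2 * (m + 1)) choose (m + 1)) = 2 * (2 * m + 1) * ((2 * m) choose m)"
proof -
  define a b c where "a = (2 * (m + 1)) choose (m + 1)" and "b = (2 * m + 1) choose m" and "c = (2 * m) choose m"
  have "(m + 1) * a = 2 * (m + 1) * b"
    using Suc_times_binomial[of m "2 * m + 1"] by (simp add: a_def b_def del: binomial_Suc_Suc)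
  moreover have "(m + 1) * b = (2 * m + 1) * c"
    using Suc_times_binomial[of m "2 * m"] binomial_symmetric[of m "2 * m + 1"]
    by (simp add: b_def c_def del: binomial_Suc_Suc)
  ultimately have "(m + 1) * a = 2 * (2 * m + 1) * c" by (simp only: mult.assoc)
  then show ?thesis by (simp only: a_def c_def)
qed

text \<open>Both sides are 1 at \<open>m = 0\<close> and satisfy
  \<open>(m + 1) u(m + 1) = 2 (2 m + 1) u(m)\<close>.\<close>

lemma gbinomial_minus_half: "(- 4) ^ m * ((- 1 / 2 :: real) gchoose m) = real ((2 * m) choose m)"
proof (induction m)
  case (Suc m)
  let ?g = "\<lambda>k. (- 1 / 2 :: real) gchoose k"
  have "real (m + 1) * ((- 4) ^ Suc m * ?g (Suc m)) = (- 4) ^ Suc m * ((- 1 / 2 - real m) * ?g m)"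
    using gbinomial_mult_1[of "- 1 / 2 :: real" m] by (simp add: algebra_simps)
  also have "\<dots> = 2 * (2 * real m + 1) * ((- 4) ^ m * ?g m)" by (simp add: algebra_simps)
  also have "\<dots> = real (2 * (2 * m + 1) * ((2 * m) choose m))" unfolding Suc.IH by (simp add: algebra_simps)
  also have "\<dots> = real (m + 1) * real ((2 * Suc m) choose Suc m)"
    unfolding central_binomial_Suc[symmetric] by (simp add: distrib_right del: binomial_Suc_Suc)
  finally have "real (m + 1) * ((- 4) ^ Suc m * ?g (Suc m)) = real (m + 1) * real ((2 * Suc m) choose Suc m)" .
  moreover have "real (m + 1) \<noteq> 0" by simp
  ultimately show ?case by (simp only: mult_cancel_left simp_thms)
qed simp

text \<open>Substituting \<open>-4 X\<close> into the series of \<open>(1 + X)^(-1/2)\<close> scales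
  the \<open>m\<close>-th coefficient by \<open>(-4)^m\<close>; the factor \<open>fps_X\<close>
  shifts \<open>m\<close> to \<open>n = m + 1\<close>.\<close>

lemma fps_central_binomial:
  "fps_X * (fps_binomial (- 1 / 2 :: real) oo (- 4 * fps_X)) =
    Abs_fps (\<lambda>n. if n \<ge> 1 then real ((2 * n - 2) choose (n - 1)) else 0)"
proof (rule fps_ext)
  fix n
  have "- 4 * fps_X = fps_const (- 4 :: real) * fps_X"
    by (simp add: numeral_fps_const)
  then show "fps_nth (fps_X * (fps_binomial (- 1 / 2 :: real) oo (- 4 * fps_X))) n =
      fps_nth (Abs_fps (\<lambda>n. if n \<ge> 1 then real ((2 * n - 2) choose (n - 1)) else 0)) n"
    by (cases n) (use gbinomial_minus_half[of "n - 1"] in \<open>simp_all add: fps_compose_linear\<close>)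
qed

text \<open>With \<open>m = n - 1\<close>, the coefficient lies between \<open>4^m / (2 m)\<close>
  and \<open>4^m\<close>, and the \<open>n\<close>-th roots of both bounds tend to 4. Taking
  \<open>n \<ge> 2\<close> keeps the denominator positive.\<close>

lemma root_central_binomial_tendsto: "(\<lambda>n. root n (real ((2 * n - 2) choose (n - 1)))) \<longlonglongrightarrow> 4"
proof (rule tendsto_sandwich)
  show "(\<lambda>n. (4 powr (real n - 1) / (2 * (real n - 1))) powr (1 / real n)) \<longlonglongrightarrow> 4" by real_asymp
  show "(\<lambda>n. (4 powr (real n - 1)) powr (1 / real n)) \<longlonglongrightarrow> 4" by real_asymp
  have eq: "root n (real ((2 * n - 2) choose (n - 1))) = real ((2 * (n - 1)) choose (n - 1)) powr (1 / real n)"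
    "4 powr (real n - 1) = 4 ^ (n - 1)" if "n \<ge> 2" for n
    using that by (simp_all add: root_powr_inverse diff_mult_distrib2 powr_realpow[symmetric] of_nat_diff)
  show "\<forall>\<^sub>F n in sequentially. (4 powr (real n - 1) / (2 * (real n - 1))) powr (1 / real n)
      \<le> root n (real ((2 * n - 2) choose (n - 1)))"
    using eventually_ge_at_top[of 2]
  proof eventually_elim
    case (elim n)
    then show ?case
      using central_binomial_lower_bound[of "n - 1"] unfolding eq[OF elim]
      by (intro powr_mono2) (simp_all add: of_nat_diff)
  qed
  show "\<forall>\<^sub>F n in sequentially. root n (real ((2 * n - 2) choose (n - 1)))
      \<le> (4 powr (real n - 1)) powr (1 / real n)"
    using eventually_ge_at_top[of 2]
  proof eventually_elim
    case (elim n)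
    have "(2 * (n - 1)) choose (n - 1) \<le> 2 ^ (2 * (n - 1))" by (rule binomial_le_pow2)
    then have "real ((2 * (n - 1)) choose (n - 1)) \<le> 4 ^ (n - 1)"
      by (metis of_nat_le_iff of_nat_numeral of_nat_power power2_eq_square power_mult numeral_times_numeral
          semiring_norm(11) semiring_norm(13))
    then show ?case unfolding eq[OF elim] by (intro powr_mono2) simp_all
  qed
qed

section \<open>Cosets of the Novikov ideal and the dimension of the multilinear part\<close>

context
  fixes X :: "'v set" and Q :: "('k::field, ('v nonassoc_monom \<Rightarrow>\<^sub>0 'k) set) module"
    and \<Phi> :: "('v nonassoc_monom \<Rightarrow>\<^sub>0 'k) \<Rightarrow> ('v nonassoc_monom \<Rightarrow>\<^sub>0 'k) set"
  defines "Q \<equiv> free_novikov X"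
    and "\<Phi> \<equiv> \<lambda>f. novikov_ideal X +>\<^bsub>free_nonassoc X :: ('k, _) module\<^esub> f"
begin

interpretation A: nonassoc_algebra "class_ring :: 'k ring" "free_nonassoc X :: ('k, 'v nonassoc_monom \<Rightarrow>\<^sub>0 'k) module"
  by (rule nonassoc_algebra_free_nonassoc)

interpretation J: abelian_subgroup "novikov_ideal X" "free_nonassoc X :: ('k, 'v nonassoc_monom \<Rightarrow>\<^sub>0 'k) module"
  by (rule A.abelian_subgroup_alg_ideal[OF alg_ideal_novikov_ideal])

lemma novikov_coset_add:
  "f \<in> carrier (free_nonassoc X :: ('k, _) module) \<Longrightarrow> g \<in> carrier (free_nonassoc X :: ('k, _) module) \<Longrightarrow>
    \<Phi> f \<oplus>\<^bsub>Q\<^esub> \<Phi> g = \<Phi> (f + g)"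
  unfolding Q_def \<Phi>_def free_novikov_def using A.quot_add[OF alg_ideal_novikov_ideal, of f g] by simp

lemma novikov_coset_scale:
  "f \<in> carrier (free_nonassoc X :: ('k, _) module) \<Longrightarrow> c \<odot>\<^bsub>Q\<^esub> \<Phi> f = \<Phi> (pscale c f)"
  unfolding Q_def \<Phi>_def free_novikov_def
  using A.quot_smult[OF alg_ideal_novikov_ideal, of c f] by (simp add: pscale_def)

lemma novikov_coset_closed: "f \<in> carrier (free_nonassoc X :: ('k, _) module) \<Longrightarrow> \<Phi> f \<in> carrier Q"
  unfolding Q_def \<Phi>_def free_novikov_def A.quot_carrier[OF alg_ideal_novikov_ideal] by blast

lemma novikov_coset_zero: "\<zero>\<^bsub>Q\<^esub> = \<Phi> 0"
  unfolding Q_def \<Phi>_def free_novikov_def using A.quot_zero[OF alg_ideal_novikov_ideal] by simp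

lemma novikov_coset_eq_iff:
  assumes "f \<in> carrier (free_nonassoc X :: ('k, _) module)" "g \<in> carrier (free_nonassoc X :: ('k, _) module)"
  shows "\<Phi> f = \<Phi> g \<longleftrightarrow> f - g \<in> novikov_ideal X"
proof
  assume "\<Phi> f = \<Phi> g"
  then have "f \<in> \<Phi> g" using J.a_rcos_self[OF assms(1)] by (simp add: \<Phi>_def)
  then show "f - g \<in> novikov_ideal X" by (auto simp: \<Phi>_def a_r_coset_def')
next
  assume "f - g \<in> novikov_ideal X"
  then show "\<Phi> f = \<Phi> g"
    unfolding \<Phi>_def using assms
    by (intro A.quot_eqI[OF alg_ideal_novikov_ideal]) (simp_all only: free_nonassoc_minus)
qed

end

text \<open>Coordinate vectors of length \<open>C\<close> are sent to cosets of combinations of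
  basis words. This linear map is onto \<open>N\<close> by spanning and injective by independence,
  so the dimension is \<open>C\<close>.\<close>

lemma novikov_codim_eq:
  assumes n: "n \<ge> 1"
  shows "novikov_codim TYPE('k::field) n = (2 * n - 2) choose (n - 1)"
proof -
  define A where "A = (free_nonassoc {1..n} :: ('k, _) module)"
  define Q where "Q = (free_novikov {1..n} :: ('k, _) module)"
  define \<Phi> where "\<Phi> = (\<lambda>f. novikov_ideal {1..n} +>\<^bsub>A\<^esub> f)"
  define N where "N = (multilinear_novikov {1..n} :: (nat nonassoc_monom \<Rightarrow>\<^sub>0 'k) set set)"
  define C where "C = card (diff_orders n)"
  have coset_fold: "novikov_ideal {1..n} +>\<^bsub>A\<^esub> f = \<Phi> f" for f by (simp only: \<Phi>_def)
  note coset = novikov_coset_add[where X = "{1..n}" and 'k = 'k, folded A_def Q_def, unfolded coset_fold]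
    novikov_coset_scale[where X = "{1..n}" and 'k = 'k, folded A_def Q_def, unfolded coset_fold]
    novikov_coset_closed[where X = "{1..n}" and 'k = 'k, folded A_def Q_def, unfolded coset_fold]
    novikov_coset_zero[where X = "{1..n}" and 'k = 'k, folded A_def Q_def, unfolded coset_fold]
    novikov_coset_eq_iff[where X = "{1..n}" and 'k = 'k, folded A_def Q_def, unfolded coset_fold]
  have subA: "pm.subspace (carrier A)" unfolding A_def by (rule subspace_free_carrier)
  have homA: "f \<in> carrier A" if "homogeneous (mset_set {1..n}) f" for f
    using that by (auto simp: A_def homogeneous_def)
  interpret Q: novikov_algebra "class_ring :: 'k ring" Q
    unfolding Q_def by (rule novikov_algebra_free_novikov)
  obtain e where e: "bij_betw e {..<C} (diff_orders n)"
    unfolding C_def lessThan_atLeast0 using ex_bij_betw_nat_finite[OF finite_diff_orders[OF n]] by blast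
  define s where "s v = (\<Sum>i<C. pscale (v $ i) (basis_word n (e i)))" for v :: "'k vec"
  have basis: "homogeneous (mset_set {1..n}) (basis_word n (e i) :: _ \<Rightarrow>\<^sub>0 'k)" if "i < C" for i
    using homogeneous_basis_word[OF n, where 'k = 'k] bij_betwE[OF e] that by auto
  have hom_s: "homogeneous (mset_set {1..n}) (s v)" for v
    unfolding s_def using basis by (intro homogeneous_sum) (auto simp: homogeneous_def)
  have sA: "s v \<in> carrier A" for v by (rule homA[OF hom_s])
  have s_add: "s (v + w) = s v + s w" if "v \<in> carrier_vec C" "w \<in> carrier_vec C" for v w
    using that by (simp add: s_def pm.scale_left_distrib sum.distrib)
  have s_scale: "s (c \<cdot>\<^sub>v v) = pscale c (s v)" if "v \<in> carrier_vec C" for c v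
    using that by (simp add: s_def pm.scale_sum_right)
  let ?M = "novikov_monom {1..n} ` multilinear_monoms {1..n} :: (nat nonassoc_monom \<Rightarrow>\<^sub>0 'k) set set"
  have monom: "novikov_monom {1..n} t = \<Phi> (Poly_Mapping.single t 1)" for t
    by (simp add: novikov_monom_def \<Phi>_def A_def)
  have single_hom: "homogeneous (mset_set {1..n}) (Poly_Mapping.single t (1::'k))"
    if "t \<in> multilinear_monoms {1..n}" for t
    using that by (simp add: multilinear_monoms_iff homogeneous_def lookup_single when_def)
  have M: "?M \<subseteq> carrier Q"
    by (intro image_subsetI, unfold monom) (intro coset(3) homA single_hom)
  have N: "N = Q.span ?M" by (simp add: N_def multilinear_novikov_def Q_def)
  have subN: "VectorSpace.subspace class_ring N Q" unfolding N by (rule Q.span_is_subspace[OF M])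
  then have N_sub: "LinearCombinations.submodule class_ring N Q" by (simp add: VectorSpace.subspace_def)
  have hom_N: "\<Phi> f \<in> N" if f: "homogeneous (mset_set {1..n}) f" for f
  proof -
    \<comment> \<open>Membership in \<open>carrier A\<close> is carried along because the coset law
      for sums is available only for summands in the carrier.\<close>
    have "\<Phi> (\<Sum>t\<in>F. pscale (Poly_Mapping.lookup f t) (Poly_Mapping.single t 1)) \<in> N
        \<and> (\<Sum>t\<in>F. pscale (Poly_Mapping.lookup f t) (Poly_Mapping.single t 1)) \<in> carrier A"
      if "finite F" "F \<subseteq> multilinear_monoms {1..n}" for F
      using that
    proof (induction F)
      case empty
      then show ?case using N_sub subA
        by (simp add: coset(4)[symmetric] LinearCombinations.submodule_def pm.subspace_def)
    next
      case (insert t F)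
      have t: "Poly_Mapping.single t 1 \<in> carrier A" using insert.prems single_hom homA by blast
      then have t': "pscale c (Poly_Mapping.single t 1) \<in> carrier A" for c
        using subA by (simp add: pm.subspace_def)
      have "\<Phi> (Poly_Mapping.single t 1) \<in> N"
        unfolding N monom[symmetric] using Q.in_own_span[OF M] insert.prems by auto
      then have "\<Phi> (pscale c (Poly_Mapping.single t 1)) \<in> N" for c
        using N_sub by (simp add: coset(2)[OF t, symmetric] LinearCombinations.submodule_def)
      then show ?case using insert N_sub subA t'
        by (simp add: coset(1)[symmetric] LinearCombinations.submodule_def pm.subspace_def)
    qed
    moreover have "Poly_Mapping.keys f \<subseteq> multilinear_monoms {1..n}"
      using f by (auto simp: homogeneous_def multilinear_monoms_iff in_keys_iff)
    ultimately show ?thesis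
      using sum_pscale_single[OF finite_keys order_refl, of f] by (metis finite_keys)
  qed
  let ?V = "module_vec TYPE('k) C"
  interpret V: vec_space "TYPE('k)" C .
  have im_submodule: "LinearCombinations.submodule class_ring (\<Phi> ` s ` carrier_vec C) Q"
  proof -
    have "\<Phi> (s v) \<oplus>\<^bsub>Q\<^esub> \<Phi> (s w) \<in> \<Phi> ` s ` carrier_vec C" if "v \<in> carrier_vec C" "w \<in> carrier_vec C" for v w
      using that by (simp add: coset(1)[OF sA sA] s_add[OF that, symmetric])
    moreover have "c \<odot>\<^bsub>Q\<^esub> \<Phi> (s v) \<in> \<Phi> ` s ` carrier_vec C" if "v \<in> carrier_vec C" for v c
      using that by (simp add: coset(2)[OF sA] s_scale[OF that, symmetric])
    moreover have "s (0\<^sub>v C) = 0" by (simp add: s_def)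
    then have "\<zero>\<^bsub>Q\<^esub> \<in> \<Phi> ` s ` carrier_vec C"
      unfolding coset(4) by (metis imageI zero_carrier_vec)
    ultimately show ?thesis
      using Q.module_axioms coset(3)[OF sA] by (auto simp: LinearCombinations.submodule_def)
  qed
  have surj: "\<Phi> ` s ` carrier_vec C = N"
  proof
    show "\<Phi> ` s ` carrier_vec C \<subseteq> N" using hom_N[OF hom_s] by blast
    show "N \<subseteq> \<Phi> ` s ` carrier_vec C"
      unfolding N
    \<comment> \<open>The image is a submodule, so reaching the cosets of the multilinear monomials
      is enough.\<close>
    proof (rule Q.span_is_subset[OF _ im_submodule], clarify)
      fix t assume t: "t \<in> multilinear_monoms {1..n}"
      obtain c where c: "Poly_Mapping.single t (1::'k) - (\<Sum>l\<in>diff_orders n. pscale (c l) (basis_word n l))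
          \<in> novikov_ideal {1..n}"
        using monom_in_span_basis_words[OF n t] by blast
      have "(\<Sum>l\<in>diff_orders n. pscale (c l) (basis_word n l)) = s (vec C (\<lambda>i. c (e i)))"
        unfolding s_def by (subst sum.reindex_bij_betw[OF e, symmetric]) simp
      with c have "\<Phi> (Poly_Mapping.single t 1) = \<Phi> (s (vec C (\<lambda>i. c (e i))))"
        using coset(5)[OF homA[OF single_hom[OF t]] sA] by simp
      then show "novikov_monom {1..n} t \<in> \<Phi> ` s ` carrier_vec C"
        unfolding monom by (metis imageI vec_carrier)
    qed
  qed
  interpret T: linear_map "class_ring :: 'k ring" ?V "Q\<lparr>carrier := N\<rparr>" "\<lambda>v. \<Phi> (s v)"
  proof -
    interpret W: vectorspace "class_ring :: 'k ring" "Q\<lparr>carrier := N\<rparr>" by (rule Q.subspace_is_vs[OF subN])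
    show "linear_map class_ring ?V (Q\<lparr>carrier := N\<rparr>) (\<lambda>v. \<Phi> (s v))"
      by unfold_locales
        (auto simp: LinearCombinations.module_hom_def module_vec_simps surj[symmetric] coset(1,2) sA s_add s_scale)
  qed
  have "inj_on (\<lambda>v. \<Phi> (s v)) (carrier ?V)"
  proof (rule inj_onI, unfold module_vec_simps)
    fix v w assume v: "v \<in> carrier_vec C" and w: "w \<in> carrier_vec C" and "\<Phi> (s v) = \<Phi> (s w)"
    then have "s v - s w \<in> novikov_ideal {1..n}" using coset(5)[OF sA sA] by simp
    \<comment> \<open>Transports the coordinate differences to order lists along the inverse of the
      enumeration \<open>e\<close>.\<close>
    moreover define c where "c l = v $ inv_into {..<C} e l - w $ inv_into {..<C} e l" for l
    have "(\<Sum>l\<in>diff_orders n. pscale (c l) (basis_word n l)) = s v - s w"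
      unfolding s_def c_def
      by (subst sum.reindex_bij_betw[OF e, symmetric])
        (simp add: bij_betw_imp_inj_on[OF e] pm.scale_left_diff_distrib sum_subtractf)
    ultimately have "(\<Sum>l\<in>diff_orders n. pscale (c l) (basis_word n l)) \<in> novikov_ideal {1..n}"
      by (simp only:)
    then have "c l = 0" if "l \<in> diff_orders n" for l
      by (rule basis_words_independent[OF n _ that])
    then have "v $ i = w $ i" if "i < C" for i
      using bij_betwE[OF e] that bij_betw_imp_inj_on[OF e] by (force simp: c_def)
    then show "v = w" using v w by (intro eq_vecI) auto
  qed
  then have "V.dim = vectorspace.dim class_ring (Q\<lparr>carrier := N\<rparr>)"
    by (intro T.dim_eq V.fin_dim) (simp_all add: module_vec_simps surj[symmetric] image_image)
  then show ?thesis
    unfolding V.dim_is_n by (simp add: novikov_codim_def Q_def N_def C_def card_diff_orders[OF n])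
qed

text \<open>Convergence is stated beside the exponent because \<open>lim\<close> is informative only
  for convergent sequences. The composed binomial series is \<open>(1 - 4 x)^(-1/2)\<close>, with
  real coefficients whatever the field.\<close>

theorem theorem1p1:
  shows "(\<forall>n\<ge>1. novikov_codim TYPE('k::field) n = (2 * n - 2) choose (n - 1)) \<and>
    (convergent (\<lambda>n. root n (real (novikov_codim TYPE('k) n))) \<and>
     codim_exponent (novikov_codim TYPE('k)) = 4) \<and>
    Abs_fps (\<lambda>n. if n \<ge> 1 then real (novikov_codim TYPE('k) n) else 0) =
      fps_X * (fps_binomial (- 1 / 2) oo (- 4 * fps_X))"
proof -
  \<comment> \<open>The formula for the codimensions holds from \<open>n = 1\<close> on, which is
    enough for the limit.\<close>
  have "(\<lambda>n. root n (real (novikov_codim TYPE('k) n))) \<longlonglongrightarrow> 4"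
    using root_central_binomial_tendsto
  proof (rule Lim_transform_eventually)
    show "\<forall>\<^sub>F n in sequentially. root n (real ((2 * n - 2) choose (n - 1))) = root n (real (novikov_codim TYPE('k) n))"
      using eventually_ge_at_top[of 1] by eventually_elim (simp add: novikov_codim_eq)
  qed
  then have "convergent (\<lambda>n. root n (real (novikov_codim TYPE('k) n)))"
    "codim_exponent (novikov_codim TYPE('k)) = 4"
    unfolding codim_exponent_def by (auto intro: convergentI limI)
  moreover have "(\<lambda>n. if n \<ge> 1 then real (novikov_codim TYPE('k) n) else 0) =
      (\<lambda>n. if n \<ge> 1 then real ((2 * n - 2) choose (n - 1)) else 0)"
    by (auto simp: novikov_codim_eq)
  ultimately show ?thesis
    by (intro conjI allI impI novikov_codim_eq) (simp_all only: fps_central_binomial)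
qed

end
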